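(* Let $\Delta \geq 4$ be an integer and let $G$ be a planar graph with maximum degree at most $\Delta$ and girth at least $7$. Then $\chi'_{\mathrm{slist}}(G) \leq 3\Delta$.
   Context: The girth of $G$ is the length of a shortest cycle in $G$ (it is $\infty$ if $G$ has no cycle). A strong edge coloring of $G$ is an assignment of colors to the edges such that any two distinct edges $e_1 = uv$ and $e_2$ receive different colors whenever $e_2$ is incident with a vertex of $N_G(u) \cup N_G(v)$. A list assignment $L$ assigns to each edge $e$ a set $L(e)$ of colors; a strong edge coloring $c$ is an $L$-coloring if $c(e) \in L(e)$ for every edge $e$. The list strong chromatic index $\chi'_{\mathrm{slist}}(G)$ is the least $k$ such that for every list assignment $L$ with $|L(e)| \geq k$ for all edges $e$, $G$ has a strong edge $L$-coloring. *)

theory Defs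
  imports "HOL-Analysis.Analysis" "HOL-Library.Extended_Nat"
begin

definition simple_graph :: "'a set \<Rightarrow> 'a set set \<Rightarrow> bool" where
  "simple_graph V E \<longleftrightarrow> finite V \<and> (\<forall>e\<in>E. e \<subseteq> V \<and> card e = 2)"

definition degree :: "'a set set \<Rightarrow> 'a \<Rightarrow> nat" where
  "degree E v = card {e\<in>E. v \<in> e}"

definition nbhd :: "'a set set \<Rightarrow> 'a \<Rightarrow> 'a set" where
  "nbhd E u = {w. {u, w} \<in> E}"

definition is_cycle :: "'a set \<Rightarrow> 'a set set \<Rightarrow> 'a list \<Rightarrow> bool" where
  "is_cycle V E vs \<longleftrightarrow> length vs \<ge> 3 \<and> distinct vs \<and> set vs \<subseteq> V \<and>
     (\<forall>i < length vs. {vs ! i, vs ! ((i + 1) mod length vs)} \<in> E)"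

text \<open>Girth: length of a shortest cycle; infinity if there is none.\<close>
definition girth :: "'a set \<Rightarrow> 'a set set \<Rightarrow> enat" where
  "girth V E = (INF vs \<in> {vs. is_cycle V E vs}. enat (length vs))"

definition planar :: "'a set \<Rightarrow> 'a set set \<Rightarrow> bool" where
  "planar V E \<longleftrightarrow> (\<exists>(f :: 'a \<Rightarrow> real \<times> real) (p :: 'a set \<Rightarrow> real \<Rightarrow> real \<times> real).
     inj_on f V \<and>
     (\<forall>e\<in>E. arc (p e) \<and> (\<exists>u v. e = {u, v} \<and> pathstart (p e) = f u \<and> pathfinish (p e) = f v)) \<and>
     (\<forall>e\<in>E. \<forall>w\<in>V - e. f w \<notin> path_image (p e)) \<and>
     (\<forall>e\<in>E. \<forall>e'\<in>E. e \<noteq> e' \<longrightarrow> path_image (p e) \<inter> path_image (p e') \<subseteq> f ` (e \<inter> e')))"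

definition strong_edge_coloring :: "'a set set \<Rightarrow> ('a set \<Rightarrow> 'c) \<Rightarrow> bool" where
  "strong_edge_coloring E c \<longleftrightarrow>
     (\<forall>e1\<in>E. \<forall>e2\<in>E. \<forall>u v. e1 = {u, v} \<and> e1 \<noteq> e2 \<and>
         e2 \<inter> (nbhd E u \<union> nbhd E v) \<noteq> {} \<longrightarrow> c e1 \<noteq> c e2)"

definition strong_L_coloring :: "'a set set \<Rightarrow> ('a set \<Rightarrow> 'c set) \<Rightarrow> ('a set \<Rightarrow> 'c) \<Rightarrow> bool" where
  "strong_L_coloring E L c \<longleftrightarrow> strong_edge_coloring E c \<and> (\<forall>e\<in>E. c e \<in> L e)"

text \<open>List strong chromatic index (colors are natural numbers; |L(e)| \<ge> k means
  L(e) infinite or of cardinality at least k).\<close>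
definition list_strong_chromatic_index :: "'a set set \<Rightarrow> nat" where
  "list_strong_chromatic_index E =
     (LEAST k. \<forall>L :: 'a set \<Rightarrow> nat set.
        (\<forall>e\<in>E. infinite (L e) \<or> k \<le> card (L e)) \<longrightarrow> (\<exists>c. strong_L_coloring E L c))"

end

theory Submission
  imports Defs
begin

text \<open>Every subgraph of a planar graph of girth at least 7 satisfies \<open>5 |E| < 7 |V|\<close>. For the topological
  definition of planarity this needs a fragment of Euler's formula: the Jordan curve theorem gives at least
  \<open>|E| - |V| + 2\<close> faces, Janiszewski's theorem shows that an edge touches at most two faces and that the edges
  touched by a face contain a cycle, so that there are at least seven of them.

  The coloring is found by induction on the number of edges. Edges with fewer than \<open>3 \<Delta>\<close> conflicts may be
  colored last; removing them repeatedly leaves a core \<open>K\<close> whose members have at least \<open>3 \<Delta>\<close> conflicts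
  inside \<open>K\<close>. If some vertex with an incident edge avoids the core, delete its edges, color the rest,
  keep the colors of \<open>K\<close> and extend greedily. Otherwise a discharging argument on the graph without its
  leaves, in which vertices of degree 2 receive charge from their neighbours, shows that its average degree is
  at least 14/5, contradicting sparsity.\<close>

section \<open>Cycles and forests\<close>

text \<open>A forest. Cycles are sought in the vertex set \<open>\<Union>H\<close>, so that the
  notion depends on the edges alone.\<close>

definition acyclic_edges :: "'a set set \<Rightarrow> bool" where
  "acyclic_edges H \<longleftrightarrow> (\<forall>vs. \<not> is_cycle (\<Union>H) H vs)"

lemma acyclic_edges_subset:
  assumes "acyclic_edges H" "H' \<subseteq> H"
  shows "acyclic_edges H'"
  using assms unfolding acyclic_edges_def is_cycle_def by (meson Union_mono order_trans subsetD)

lemma is_cycle_mono: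
  assumes "is_cycle V H vs" "V \<subseteq> V'" "H \<subseteq> H'"
  shows "is_cycle V' H' vs"
  using assms unfolding is_cycle_def by blast

text \<open>Two edges between consecutive vertices could coincide only if each of two positions
  followed the other, which length at least 3 excludes.\<close>

lemma length_cycle_le_card:
  assumes "is_cycle V E vs" "finite E"
  shows "length vs \<le> card E"
proof -
  define n where "n = length vs"
  have n: "n \<ge> 3" and dist: "distinct vs"
    using assms unfolding is_cycle_def n_def by auto
  let ?g = "\<lambda>i. {vs ! i, vs ! ((i + 1) mod n)}"
  have md: "(i + 1) mod n = (if i + 1 = n then 0 else i + 1)" if "i < n" for i
    using that n by auto
  have "inj_on ?g {..<n}"
  proof (rule inj_onI)
    fix i j assume ij: "i \<in> {..<n}" "j \<in> {..<n}" "?g i = ?g j"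
    let ?a = "(i + 1) mod n" and ?b = "(j + 1) mod n"
    have lt: "i < n" "j < n" "?a < n" "?b < n" using ij n by auto
    have "(vs ! i = vs ! j \<or> (vs ! i = vs ! ?b \<and> vs ! j = vs ! ?a))"
      using ij(3) by (metis doubleton_eq_iff)
    then have "i = j \<or> (i = ?b \<and> j = ?a)"
      using lt dist unfolding n_def by (metis nth_eq_iff_index_eq)
    then show "i = j"
      using md[of i] md[of j] lt n by (auto split: if_splits)
  qed
  moreover have "?g ` {..<n} \<subseteq> E"
    using assms unfolding is_cycle_def n_def by auto
  ultimately show ?thesis
    using card_inj_on_le[of ?g "{..<n}" E] assms(2) unfolding n_def by auto
qed

text \<open>At the first vertex \<open>u\<close> of a longest path, any edge other than the first
  path edge would lengthen the path or close a cycle.\<close>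

lemma acyclic_edges_leaf:
  assumes fin: "finite H" and two: "\<And>e. e \<in> H \<Longrightarrow> card e = 2" and "H \<noteq> {}" and ac: "acyclic_edges H"
  obtains u v where "{u, v} \<in> H" "u \<noteq> v" "\<forall>e\<in>H. u \<in> e \<longrightarrow> e = {u, v}"
proof -
  have finU: "finite (\<Union>H)"
    using fin two by (metis card.infinite finite_Union zero_neq_numeral)
  define Q where "Q = (\<lambda>vs. distinct vs \<and> length vs \<ge> 2 \<and> set vs \<subseteq> \<Union>H \<and>
      (\<forall>i. Suc i < length vs \<longrightarrow> {vs ! i, vs ! Suc i} \<in> H))"
  obtain e where "e \<in> H" using assms by auto
  then obtain a b where ab: "e = {a, b}" "a \<noteq> b" using two by (metis card_2_iff)
  have "Q [a, b]" using ab \<open>e \<in> H\<close> unfolding Q_def by auto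
  moreover have "\<And>vs. Q vs \<Longrightarrow> length vs < Suc (card (\<Union>H))"
    unfolding Q_def by (metis card_mono distinct_card finU less_Suc_eq_le)
  ultimately obtain vs where vs: "Q vs" and mx: "\<And>ws. Q ws \<Longrightarrow> length ws \<le> length vs"
    using ex_has_greatest_nat[of Q "[a,b]" length] by (metis less_imp_le)
  obtain u v ws where uv: "vs = u # v # ws"
  proof (cases vs)
    case (Cons a xs)
    then show thesis using vs that unfolding Q_def by (cases xs) auto
  qed (use vs in \<open>auto simp: Q_def\<close>)
  have e1: "{u, v} \<in> H" using vs unfolding Q_def uv by force
  have "u \<noteq> v" using vs unfolding Q_def uv by auto
  moreover have "e = {u, v}" if e: "e \<in> H" "u \<in> e" for e
  proof (rule ccontr)
    assume ne: "e \<noteq> {u, v}"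
    obtain z where z: "e = {u, z}" "z \<noteq> u"
      using two[OF e(1)] e(2) by (metis card_2_iff doubleton_eq_iff insertE singletonD)
    have zv: "z \<noteq> v" using ne z by auto
    show False
    proof (cases "z \<in> set vs")
      case False
      have "Q (z # vs)"
        using vs False e z unfolding Q_def
        by (auto simp: nth_Cons uv insert_commute split: nat.splits)
      then show False using mx[of "z # vs"] by simp
    next
      case True
      then obtain i where i: "i < length vs" "vs ! i = z" by (auto simp: in_set_conv_nth)
      \<comment> \<open>The initial segment up to \<open>z\<close> has at least three vertices,
        because \<open>z\<close> is neither of the first two.\<close>
      have i2: "i \<ge> 2" using i z zv uv by (cases i; cases "i - 1") auto
      let ?c = "take (i + 1) vs"
      have len: "length ?c = i + 1" using i by simp
      have "is_cycle (\<Union>H) H ?c"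
        unfolding is_cycle_def len
      proof (intro conjI allI impI)
        show "distinct ?c" "set ?c \<subseteq> \<Union>H"
          using vs set_take_subset[of "i+1" vs] unfolding Q_def by (auto simp: distinct_take)
        fix j assume j: "j < i + 1"
        show "{?c ! j, ?c ! ((j + 1) mod (i + 1))} \<in> H"
        proof (cases "j = i")
          case True
          have "?c ! i = z" "?c ! 0 = u" using i i2 by (simp_all add: uv)
          then show ?thesis using True e(1) z by (simp add: insert_commute)
        next
          case False
          then have "(j + 1) mod (i + 1) = j + 1" using j by simp
          then show ?thesis using vs i j False unfolding Q_def by auto
        qed
      qed (use i2 in auto)
      then show False using ac unfolding acyclic_edges_def by blast
    qed
  qed
  ultimately show ?thesis using e1 that by blast
qed

text \<open>Induction: a leaf is removed together with its only edge.\<close>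

lemma acyclic_edges_card:
  assumes "finite V" "V \<noteq> {}" "finite H" "\<And>e. e \<in> H \<Longrightarrow> e \<subseteq> V \<and> card e = 2" "acyclic_edges H"
  shows "card H + 1 \<le> card V"
  using assms(3,1,2,4,5)
proof (induction "card H" arbitrary: H V)
  case 0
  then show ?case by (simp add: Suc_le_eq card_gt_0_iff)
next
  case (Suc n)
  then have "H \<noteq> {}" by auto
  then obtain u v where uv: "{u, v} \<in> H" "u \<noteq> v" "\<forall>e\<in>H. u \<in> e \<longrightarrow> e = {u, v}"
    using acyclic_edges_leaf[of H] Suc.prems by metis
  have uV: "u \<in> V" "v \<in> V" using uv Suc.prems by auto
  have "card (H - {{u, v}}) + 1 \<le> card (V - {u})"
  proof (rule Suc.hyps(1))
    show "n = card (H - {{u, v}})" using Suc.hyps(2) uv(1) Suc.prems(1) by simp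
    show "acyclic_edges (H - {{u, v}})" 
      by (rule acyclic_edges_subset[OF Suc.prems(5)]) auto
    show "e \<subseteq> V - {u} \<and> card e = 2" if "e \<in> H - {{u, v}}" for e
      using that Suc.prems(4) uv(3) by blast
    show "V - {u} \<noteq> {}" using uV(2) uv(2) by blast
  qed (use Suc.prems(1,2) in simp_all)
  moreover have "card V = card (V - {u}) + 1" "card H = card (H - {{u, v}}) + 1"
    using card.remove[OF Suc.prems(2) uV(1)] card.remove[OF Suc.prems(1) uv(1)] by simp_all
  ultimately show ?case by linarith
qed

text \<open>The edge is the one closing the cycle; the remaining edges of the cycle form the
  detour.\<close>

lemma cycle_edge_detour:
  assumes "is_cycle V E vs"
  obtains u v where "{u, v} \<in> E" "u \<noteq> v" "(u, v) \<in> {(x, y). {x, y} \<in> E - {{u, v}}}\<^sup>*"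
proof -
  let ?n = "length vs"
  have n: "?n \<ge> 3" and dist: "distinct vs"
    and ed: "\<And>i. i < ?n \<Longrightarrow> {vs ! i, vs ! ((i + 1) mod ?n)} \<in> E"
    using assms unfolding is_cycle_def by auto
  let ?u = "vs ! 0" and ?v = "vs ! (?n - 1)"
  let ?R = "{(x, y). {x, y} \<in> E - {{?u, ?v}}}"
  have "?n - 1 + 1 = ?n" using n by linarith
  then have "(?n - 1 + 1) mod ?n = 0" by (metis mod_self)
  then have uv: "{?u, ?v} \<in> E" using ed[of "?n - 1"] n by (metis diff_less gr0I insert_commute not_numeral_le_zero zero_less_one)
  have "?u \<noteq> ?v" using dist n by (subst nth_eq_iff_index_eq) auto
  have "(?u, vs ! i) \<in> ?R\<^sup>*" if "i < ?n" for i
    using that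
  proof (induction i)
    case (Suc i)
    have "{vs ! i, vs ! Suc i} \<in> E" using ed[of i] Suc.prems by simp
    moreover have "{vs ! i, vs ! Suc i} \<noteq> {?u, ?v}"
    proof
      assume "{vs ! i, vs ! Suc i} = {?u, ?v}"
      then have "(vs ! i = ?u \<and> vs ! Suc i = ?v) \<or> (vs ! i = ?v \<and> vs ! Suc i = ?u)"
        by (simp add: doubleton_eq_iff)
      moreover have "i < ?n" "0 < ?n" "?n - 1 < ?n" using n Suc.prems by auto
      ultimately have "(i = 0 \<and> Suc i = ?n - 1) \<or> (i = ?n - 1 \<and> Suc i = 0)"
        using nth_eq_iff_index_eq[OF dist] Suc.prems by simp
      then show False using n by auto
    qed
    ultimately have "(vs ! i, vs ! Suc i) \<in> ?R" by simp
    then show ?case using Suc by (meson Suc_lessD rtrancl.rtrancl_into_rtrancl)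
  qed simp
  then have "(?u, ?v) \<in> ?R\<^sup>*" using n by simp
  then show ?thesis using that uv \<open>?u \<noteq> ?v\<close> by blast
qed

section \<open>Faces of a plane drawing\<close>

text \<open>Only the image \<open>I e\<close> of an edge is fixed, so that its parametrization can
  be chosen and reversed freely. The plane is \<open>complex\<close>, the type in which the Jordan
  curve theorem and Janiszewski's theorem are stated.\<close>

locale drawing =
  fixes V :: "'a set" and E :: "'a set set" and f :: "'a \<Rightarrow> complex" and I :: "'a set \<Rightarrow> complex set"
  assumes finV: "finite V"
    and edge: "e \<in> E \<Longrightarrow> e \<subseteq> V \<and> card e = 2"
    and inj: "inj_on f V"
    and arcs: "e \<in> E \<Longrightarrow> \<exists>g u v. arc g \<and> path_image g = I e \<and> e = {u, v} \<and> pathstart g = f u \<and> pathfinish g = f v"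
    and avoid: "e \<in> E \<Longrightarrow> w \<in> V - e \<Longrightarrow> f w \<notin> I e"
    and meet: "e \<in> E \<Longrightarrow> e' \<in> E \<Longrightarrow> e \<noteq> e' \<Longrightarrow> I e \<inter> I e' \<subseteq> f ` (e \<inter> e')"
begin

definition X :: "'a set set \<Rightarrow> complex set" where "X H = \<Union> (I ` H)"

definition inner :: "'a set \<Rightarrow> complex set" where "inner e = I e - f ` e"

lemma finE: "finite E"
  by (rule finite_subset[of _ "Pow V"]) (use finV edge in auto)

lemma edge_arc:
  assumes "{u, v} \<in> E"
  obtains g where "arc g" "path_image g = I {u, v}" "pathstart g = f u" "pathfinish g = f v"
proof -
  obtain g a b where g: "arc g" "path_image g = I {u, v}" "{u, v} = {a, b}" "pathstart g = f a" "pathfinish g = f b"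
    using arcs[OF assms] by blast
  show ?thesis
  proof (cases "u = a \<and> v = b")
    case True
    then show ?thesis using g that by simp
  next
    case False
    then have "u = b" "v = a" using g(3) by (auto simp: doubleton_eq_iff)
    then show ?thesis
      using g that[of "reversepath g"] by (simp add: arc_reversepath)
  qed
qed

lemma edge_pair:
  assumes "e \<in> E" obtains u v where "e = {u, v}" "u \<noteq> v" "u \<in> V" "v \<in> V" "f u \<noteq> f v"
proof -
  obtain u v where "e = {u, v}" "u \<noteq> v" using edge[OF assms] by (metis card_2_iff)
  moreover then have "u \<in> V" "v \<in> V" using edge[OF assms] by auto
  moreover then have "f u \<noteq> f v" using inj \<open>u \<noteq> v\<close> by (meson inj_onD)
  ultimately show ?thesis using that by blast
qed

lemma compact_I: "e \<in> E \<Longrightarrow> compact (I e)"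
  using arcs compact_arc_image by metis

lemma compact_X: "H \<subseteq> E \<Longrightarrow> compact (X H)"
  unfolding X_def using finE finite_subset compact_I by (intro compact_UN) auto

lemma closed_X: "H \<subseteq> E \<Longrightarrow> closed (X H)"
  by (simp add: compact_X compact_imp_closed)

lemma open_Compl_X: "H \<subseteq> E \<Longrightarrow> open (- X H)"
  by (simp add: closed_X open_Compl)

lemma X_Un: "X (A \<union> B) = X A \<union> X B"
  unfolding X_def by auto

lemma X_insert: "X (insert e A) = I e \<union> X A"
  unfolding X_def by auto

lemma X_mono: "A \<subseteq> B \<Longrightarrow> X A \<subseteq> X B"
  unfolding X_def by auto

lemma I_Int_X:
  assumes "e \<in> E" "H \<subseteq> E" "e \<notin> H"
  shows "I e \<inter> X H \<subseteq> f ` (e \<inter> \<Union>H)"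
  using assms meet unfolding X_def by fastforce

lemma X_Int_X:
  assumes "A \<subseteq> E" "B \<subseteq> E" "A \<inter> B = {}"
  shows "X A \<inter> X B \<subseteq> f ` (\<Union>A \<inter> \<Union>B)"
proof
  fix z assume "z \<in> X A \<inter> X B"
  then obtain a b where "a \<in> A" "b \<in> B" "z \<in> I a" "z \<in> I b" unfolding X_def by auto
  moreover then have "a \<noteq> b" using assms by auto
  ultimately have "z \<in> f ` (a \<inter> b)" using meet assms by blast
  then show "z \<in> f ` (\<Union>A \<inter> \<Union>B)" using \<open>a \<in> A\<close> \<open>b \<in> B\<close> by blast
qed

lemma inner_disjoint:
  assumes "e \<in> E" "H \<subseteq> E" "e \<notin> H"
  shows "inner e \<inter> X H = {}"
  using I_Int_X[OF assms] unfolding inner_def by blast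

lemma inner_not_vertex:
  assumes "e \<in> E" "z \<in> inner e" shows "z \<notin> f ` V"
  using assms avoid unfolding inner_def by blast

lemma inner_image:
  assumes "e \<in> E"
  obtains g where "arc g" "path_image g = I e" "inner e = g ` {0<..<1}"
proof -
  obtain g u v where g: "arc g" "path_image g = I e" "e = {u, v}" "pathstart g = f u" "pathfinish g = f v"
    using arcs[OF assms] by blast
  have inj: "inj_on g {0..1}" using g(1) by (simp add: arc_def)
  have "{0..1} = insert 0 (insert 1 {0<..<1::real})" by auto
  then have im: "I e = insert (g 0) (insert (g 1) (g ` {0<..<1}))"
    using g(2) unfolding path_image_def by (metis image_insert)
  have "g 0 \<notin> g ` {0<..<1}" "g 1 \<notin> g ` {0<..<1}"
    using inj_onD[OF inj] by force+
  then have "inner e = g ` {0<..<1}"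
    using im g(3-5) unfolding inner_def pathstart_def pathfinish_def by auto
  then show ?thesis using that g by blast
qed

lemma connected_inner: "e \<in> E \<Longrightarrow> connected (inner e)"
proof -
  assume "e \<in> E"
  then obtain g where g: "arc g" "inner e = g ` {0<..<1}" using inner_image by metis
  have "continuous_on {0..1} g" using g(1) by (simp add: arc_def path_def)
  then have "continuous_on {0<..<1} g" by (rule continuous_on_subset) auto
  then show ?thesis using g by (simp add: connected_continuous_image)
qed

lemma inner_nonempty: "e \<in> E \<Longrightarrow> inner e \<noteq> {}"
proof -
  assume "e \<in> E"
  then obtain g where "inner e = g ` {0<..<1::real}" using inner_image by metis
  then show ?thesis by auto
qed

section \<open>Complements of arcs and forests, and closed curves inside the drawing\<close>

lemma connected_Compl_I: "e \<in> E \<Longrightarrow> connected (- I e)"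
  using arcs connected_arc_complement[where ?'a = complex] by (metis DIM_complex order_refl)

lemma connected_subset_singleton: "S \<subseteq> {a :: complex} \<Longrightarrow> connected S"
  by (metis connected_empty connected_sing subset_singletonD)

text \<open>Induction over leaf edges: such an arc does not separate the plane and meets the rest in
  at most one point, a connected set, so Janiszewski's theorem keeps the complement
  connected.\<close>

lemma connected_Compl_forest:
  assumes "H \<subseteq> E" "acyclic_edges H"
  shows "connected (- X H)"
  using assms
proof (induction "card H" arbitrary: H)
  case 0
  then have "H = {}" using finE finite_subset by (metis card_0_eq)
  then show ?case unfolding X_def by (simp add: convex_connected)
next
  case (Suc n)
  have fin: "finite H" using finE finite_subset Suc.prems by auto
  have ne: "H \<noteq> {}" using Suc.hyps(2) by auto
  have two: "card e = 2" if "e \<in> H" for e using that edge Suc.prems(1) by blast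
  obtain u v where uv: "{u, v} \<in> H" "u \<noteq> v" "\<forall>e\<in>H. u \<in> e \<longrightarrow> e = {u, v}"
    using acyclic_edges_leaf[OF fin two ne Suc.prems(2)] by metis
  let ?H = "H - {{u, v}}"
  have HE: "?H \<subseteq> E" "{u, v} \<in> E" using Suc.prems(1) uv(1) by auto
  have "acyclic_edges ?H" by (rule acyclic_edges_subset[OF Suc.prems(2)]) auto
  moreover have "n = card ?H" using Suc.hyps(2) uv(1) fin by simp
  ultimately have IH: "connected (- X ?H)" using Suc.hyps(1) HE by blast
  have H: "X H = X ?H \<union> I {u, v}"
    using X_insert[of "{u, v}" ?H] uv(1) by (simp add: insert_absorb sup_commute)
  have "I {u, v} \<inter> X ?H \<subseteq> f ` ({u, v} \<inter> \<Union>?H)"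
    by (rule I_Int_X) (use HE in auto)
  also have "\<dots> \<subseteq> {f v}" using uv(3) by blast
  finally have "connected (X ?H \<inter> I {u, v})"
    by (simp add: Int_commute connected_subset_singleton)
  then show ?case
    unfolding H using Janiszewski_connected[OF compact_X[OF HE(1)] _ _ IH connected_Compl_I[OF HE(2)]]
      compact_imp_closed[OF compact_I[OF HE(2)]] by blast
qed

lemma restrict_drawing:
  assumes "V' \<subseteq> V" "E' \<subseteq> E" "\<Union>E' \<subseteq> V'"
  shows "drawing V' E' f I"
proof -
  have E': "e \<in> E" "e \<subseteq> V'" if "e \<in> E'" for e using that assms by auto
  show ?thesis
  proof (rule drawing.intro)
    show "finite V'" by (rule finite_subset[OF assms(1) finV])
    show "inj_on f V'" by (rule inj_on_subset[OF inj assms(1)])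
    show "e \<subseteq> V' \<and> card e = 2" if "e \<in> E'" for e using E' edge that by blast
    show "f w \<notin> I e" if "e \<in> E'" "w \<in> V' - e" for e w using E'(1) avoid that assms(1) by blast
  next
    fix e assume "e \<in> E'"
    then have "e \<in> E" by (rule E'(1))
    then show "\<exists>g u v. arc g \<and> path_image g = I e \<and> e = {u, v} \<and> pathstart g = f u \<and> pathfinish g = f v"
      by (rule arcs)
  next
    fix e e' assume "e \<in> E'" "e' \<in> E'" "e \<noteq> e'"
    then show "I e \<inter> I e' \<subseteq> f ` (e \<inter> e')" by (intro meet E'(1))
  qed
qed

text \<open>A walk in the graph is traced by the arcs of its edges. The condition
  \<open>u \<noteq> w\<close> excludes the empty walk, whose vertex may lie off
  \<open>X H\<close>.\<close>

lemma reach_path_component: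
  assumes "(u, w) \<in> {(x, y). {x, y} \<in> H}\<^sup>*" "H \<subseteq> E" "u \<noteq> w"
  shows "path_component (X H) (f u) (f w)"
proof -
  have "u = w \<or> path_component (X H) (f u) (f w)"
    using assms(1)
  proof (induction rule: rtrancl_induct)
    case (step y z)
    then have yz: "{y, z} \<in> H" by simp
    then obtain g where g: "arc g" "path_image g = I {y, z}" "pathstart g = f y" "pathfinish g = f z"
      using edge_arc assms(2) by blast
    have "path_component (X H) (f y) (f z)"
      unfolding path_component_def
      using g yz by (intro exI[of _ g]) (auto simp: X_def arc_imp_path)
    then show ?case using step.IH path_component_trans by metis
  qed simp
  then show ?thesis using assms(3) by blast
qed

text \<open>An arc through the rest of the drawing joins the ends of the edge and meets the edge
  only there, so the two form a Jordan curve. The last conclusion is the connectedness that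
  Janiszewski's theorem asks for.\<close>

lemma edge_on_curve:
  assumes e: "{u, v} \<in> E" "u \<noteq> v" and pc: "path_component (X (E - {{u, v}})) (f u) (f v)"
  obtains c where "simple_path c" "pathfinish c = pathstart c" "I {u, v} \<subseteq> path_image c"
    "path_image c \<subseteq> X E" "connected (X (E - {{u, v}}) \<inter> path_image c)"
proof -
  let ?e = "{u, v}"
  obtain g where g: "arc g" "path_image g = I ?e" "pathstart g = f u" "pathfinish g = f v"
    using edge_arc e by blast
  have ne: "f u \<noteq> f v" using e edge inj by (metis inj_onD insert_subset)
  obtain p where p: "path p" "path_image p \<subseteq> X (E - {?e})" "pathstart p = f u" "pathfinish p = f v"
    using pc unfolding path_component_def by blast
  obtain q where q: "arc q" "path_image q \<subseteq> path_image p" "pathstart q = f u" "pathfinish q = f v"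
    using path_contains_arc[OF p(1,3,4) ne] by blast
  have sub: "path_image q \<subseteq> X (E - {?e})" using p q by blast
  have meet': "I ?e \<inter> X (E - {?e}) \<subseteq> {f u, f v}"
    using I_Int_X[of ?e "E - {?e}"] e by auto
  let ?c = "g +++ reversepath q"
  have im: "path_image ?c = I ?e \<union> path_image q"
    using g q by (simp add: path_image_join)
  have "simple_path ?c"
    by (rule simple_path_join_loop) (use g q meet' sub in \<open>auto simp: arc_reversepath\<close>)
  moreover have "path_image ?c \<subseteq> X E"
    unfolding im using sub X_mono[of "E - {?e}" E] e unfolding X_def by blast
  \<comment> \<open>The rest of the drawing meets the edge only at its ends, which lie on
    \<open>q\<close>; what remains is the arc \<open>q\<close> itself.\<close>
  moreover have "X (E - {?e}) \<inter> path_image ?c = path_image q"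
  proof -
    have "{f u, f v} \<subseteq> path_image q"
      using q by (metis empty_subsetI insert_subset pathfinish_in_path_image pathstart_in_path_image)
    then show ?thesis unfolding im using meet' sub by blast
  qed
  ultimately show ?thesis
    using that[of ?c] im g q by (simp add: connected_arc_image)
qed

text \<open>A face is given by a point \<open>a\<close> in it. Because only inner points of the edge
  are tested, a face that reaches the edge only at an end does not count. For \<open>a\<close> on
  the drawing the component is empty and touches nothing.\<close>

definition touches :: "complex \<Rightarrow> 'a set \<Rightarrow> bool" where
  "touches a e \<longleftrightarrow> inner e \<inter> closure (connected_component_set (- X E) a) \<noteq> {}"

lemma X_remove: "e \<in> E \<Longrightarrow> X E = X (E - {e}) \<union> I e"
  using X_insert[of e "E - {e}"] by (simp add: insert_absorb Un_commute)

lemma cc_mono: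
  assumes "connected_component (- X E) a b" "H \<subseteq> E"
  shows "connected_component (- X H) a b"
  using assms X_mono[OF assms(2)] connected_component_of_subset by (metis Compl_anti_mono)

text \<open>Deleting \<open>e\<close> joins all faces that touch it: a small disc around an inner
  point of \<open>e\<close> misses the other edges, and the inner points of \<open>e\<close> form a
  connected set.\<close>

lemma touches_connected:
  assumes "e \<in> E" "touches a e" "touches b e"
  shows "connected_component (- X (E - {e})) a b"
proof -
  let ?H = "E - {e}"
  have in1: "inner e \<inter> X ?H = {}" by (rule inner_disjoint) (use assms in auto)
  have *: "\<exists>x\<in>inner e. connected_component (- X ?H) a x" if ta: "touches a e" for a
  proof -
    obtain x where x: "x \<in> inner e" "x \<in> closure (connected_component_set (- X E) a)"
      using ta unfolding touches_def by blast
    have "x \<in> - X ?H" using x in1 by blast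
    then obtain r where r: "r > 0" "ball x r \<subseteq> - X ?H"
      using open_Compl_X[of ?H] openE by blast
    then obtain y where y: "y \<in> connected_component_set (- X E) a" "dist y x < r"
      using x(2) unfolding closure_approachable by blast
    then have "connected_component (- X ?H) y x"
      using connected_component_of_subset[OF _ r(2)] r(1)
        connected_componentI[of "ball x r" "ball x r" y x] by (simp add: dist_commute)
    moreover have "connected_component (- X ?H) a y" using y cc_mono by blast
    ultimately show ?thesis using x(1) connected_component_trans by metis
  qed
  obtain x y where xy: "x \<in> inner e" "connected_component (- X ?H) a x"
    "y \<in> inner e" "connected_component (- X ?H) b y"
    using * assms by metis
  have "connected_component (- X ?H) x y"
    using connected_componentI[OF connected_inner[OF assms(1)], of "- X ?H"] in1 xy by blast
  then show ?thesis using xy by (metis connected_component_sym connected_component_trans)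
qed

text \<open>The rest of the drawing splits into the edges \<open>A\<close> on the side of
  \<open>u\<close> and the remaining edges \<open>B\<close>. The bridge is glued to
  \<open>A\<close>, then \<open>B\<close> to the result; each intersection has at most one point, so
  Janiszewski's theorem applies twice.\<close>

lemma bridge_one_side:
  assumes e: "{u, v} \<in> E" and nr: "(u, v) \<notin> {(x, y). {x, y} \<in> E - {{u, v}}}\<^sup>*"
    and cc: "connected_component (- X (E - {{u, v}})) a b" and ab: "a \<notin> X E" "b \<notin> X E"
  shows "connected_component (- X E) a b"
proof -
  let ?e = "{u, v}" let ?R = "{(x, y). {x, y} \<in> E - {?e}}"
  define W where "W = {w. (u, w) \<in> ?R\<^sup>*}"
  define A where "A = {h \<in> E - {?e}. h \<inter> W \<noteq> {}}"
  define B where "B = {h \<in> E - {?e}. h \<inter> W = {}}"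
  have AB: "A \<subseteq> E" "B \<subseteq> E" "A \<inter> B = {}" "?e \<notin> A" "?e \<notin> B" "E - {?e} = A \<union> B"
    unfolding A_def B_def by auto
  have AW: "\<Union>A \<subseteq> W"
  proof
    fix y assume "y \<in> \<Union>A"
    then obtain h x where h: "h \<in> E - {?e}" "y \<in> h" "x \<in> h" "x \<in> W" unfolding A_def by blast
    show "y \<in> W"
    proof (cases "x = y")
      case False
      obtain s t where "h = {s, t}" using h(1) edge_pair by (metis DiffD1)
      then have "h = {x, y}" using h(2,3) False by blast
      then have "(x, y) \<in> ?R" using h(1) by simp
      moreover have "(u, x) \<in> ?R\<^sup>*" using h(4) unfolding W_def by simp
      ultimately have "(u, y) \<in> ?R\<^sup>*" by (rule rtrancl_into_rtrancl[rotated])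
      then show ?thesis unfolding W_def by simp
    qed (use h in simp)
  qed
  have uW: "u \<in> W" "v \<notin> W" using nr unfolding W_def by auto
  have BW: "\<Union>B \<inter> W = {}" unfolding B_def by auto
  have cA: "connected_component (- X A) a b" and cB: "connected_component (- X B) a b"
    using connected_component_of_subset[OF cc] unfolding AB(6) X_Un by blast+
  have abI: "a \<in> - I ?e" "b \<in> - I ?e" using ab e unfolding X_def by blast+
  have cI: "connected_component (- I ?e) a b"
    using connected_Compl_I[OF e] abI unfolding connected_iff_connected_component by blast
  have "X A \<inter> I ?e \<subseteq> {f u}"
    using I_Int_X[OF e AB(1,4)] AW uW by blast
  then have c1: "connected_component (- (X A \<union> I ?e)) a b"
    using Janiszewski[OF compact_X[OF AB(1)] compact_imp_closed[OF compact_I[OF e]] _ cA cI]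
      connected_subset_singleton by blast
  have "X B \<inter> I ?e \<subseteq> {f v}"
    using I_Int_X[OF e AB(2,5)] BW uW by blast
  moreover have "X A \<inter> X B = {}"
    using X_Int_X[OF AB(1-3)] AW BW by blast
  ultimately have "X B \<inter> (X A \<union> I ?e) \<subseteq> {f v}" by blast
  then have "connected (X B \<inter> (X A \<union> I ?e))" by (rule connected_subset_singleton)
  then have "connected_component (- (X B \<union> (X A \<union> I ?e))) a b"
    using Janiszewski[OF compact_X[OF AB(2)] _ _ cB c1]
      compact_imp_closed[OF compact_Un[OF compact_X[OF AB(1)] compact_I[OF e]]] by simp
  moreover have "X B \<union> (X A \<union> I ?e) = X E"
    using X_remove[OF e] unfolding AB(6) X_Un by blast
  ultimately show ?thesis by simp
qed

lemma touches_off: "touches a e \<Longrightarrow> a \<notin> X E"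
  using connected_component_eq_empty[of "- X E" a] unfolding touches_def by fastforce

text \<open>If the edge lies on a Jordan curve contained in the drawing, then two faces on the same side of the
  curve that touch the edge coincide by Janiszewski's theorem, since the rest of the drawing meets the
  curve in a connected set. A bridge touches a single face.\<close>

lemma edge_two_sides:
  assumes e: "e \<in> E" and t: "touches a e" "touches b e" "touches c e"
  shows "connected_component (- X E) a b \<or> connected_component (- X E) a c \<or> connected_component (- X E) b c"
proof -
  obtain u v where uv: "e = {u, v}" "u \<noteq> v" using edge_pair[OF e] by metis
  have off: "a \<notin> X E" "b \<notin> X E" "c \<notin> X E" using t touches_off by auto
  show ?thesis
  proof (cases "(u, v) \<in> {(x, y). {x, y} \<in> E - {{u, v}}}\<^sup>*")
    case False
    then show ?thesis
      using bridge_one_side[of u v a b] touches_connected[OF e t(1,2)] off e uv by blast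
  next
    case True
    then have "path_component (X (E - {{u, v}})) (f u) (f v)"
      using reach_path_component uv(2) by blast
    then obtain g where g: "simple_path g" "pathfinish g = pathstart g" "I e \<subseteq> path_image g"
      "path_image g \<subseteq> X E" "connected (X (E - {e}) \<inter> path_image g)"
      using edge_on_curve[of u v] e uv by metis
    have X: "X (E - {e}) \<union> path_image g = X E"
      using X_remove[OF e] g(3,4) by blast
    have J: "connected (inside (path_image g))" "connected (outside (path_image g))"
      "inside (path_image g) \<union> outside (path_image g) = - path_image g"
      using Jordan_inside_outside[OF g(1,2)] by auto
    have same: "connected_component (- X E) x y"
      if "touches x e" "touches y e" "S \<subseteq> - path_image g" "connected S" "x \<in> S" "y \<in> S" for x y S
      using Janiszewski[OF compact_X[of "E - {e}"] closed_simple_path_image[OF g(1)] g(5)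
          touches_connected[OF e that(1,2)] connected_componentI[OF that(4,3,5,6)]] X by auto
    have ins: "S \<subseteq> - path_image g" if "S = inside (path_image g) \<or> S = outside (path_image g)" for S
      using that J(3) by blast
    have "x \<in> inside (path_image g) \<or> x \<in> outside (path_image g)" if "x \<notin> X E" for x
      using that J(3) g(4) by blast
    then show ?thesis using same[OF _ _ ins J(1)] same[OF _ _ ins J(2)] t off by meson
  qed
qed

text \<open>A forest does not separate the plane, so a face bounded by a forest would be everything outside it.\<close>

lemma face_touches_cycle:
  assumes a: "a \<notin> X E" and nac: "\<not> acyclic_edges E"
  shows "\<not> acyclic_edges {e \<in> E. touches a e}"
proof
  let ?H = "{e \<in> E. touches a e}"
  assume ac: "acyclic_edges ?H"
  let ?F = "connected_component_set (- X E) a"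
  \<comment> \<open>The vertices are removed as well, so that a boundary point of the face left in
    \<open>?W\<close> would have to be an inner point of an edge, which is then touched.\<close>
  let ?W = "- X ?H - f ` V"
  have H: "?H \<subseteq> E" by auto
  have "connected ?W"
    by (rule connected_open_delete_finite)
       (use connected_Compl_forest[OF H ac] open_Compl_X[OF H] finV in auto)
  have openF: "open ?F" using open_Compl_X[of E] open_connected_component by blast
  have cl: "closure ?F \<inter> ?W \<subseteq> ?F"
  proof
    fix z assume z: "z \<in> closure ?F \<inter> ?W"
    have "z \<notin> X E"
    proof
      assume "z \<in> X E"
      then obtain e where e: "e \<in> E" "z \<in> I e" unfolding X_def by auto
      then have "z \<in> inner e" using z edge[OF e(1)] unfolding inner_def by blast
      then have "touches a e" using z unfolding touches_def by blast
      then show False using z e unfolding X_def by blast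
    qed
    then obtain r where r: "r > 0" "ball z r \<subseteq> - X E"
      using open_Compl_X[of E] openE by blast
    obtain y where y: "y \<in> ?F" "dist y z < r"
      using IntD1[OF z] r(1) unfolding closure_approachable by blast
    have "connected_component (- X E) y z"
      using connected_componentI[of "ball z r" "- X E" y z] r y by (simp add: dist_commute)
    then show "z \<in> ?F" using y connected_component_trans by auto
  qed
  have aF: "a \<in> ?F" using a by simp
  \<comment> \<open>The drawing has a cycle and the touched edges have none, so some edge is
    untouched. Its inner points lie in \<open>?W\<close> but not in the face, although the face
    fills the connected set \<open>?W\<close>.\<close>
  obtain e where e: "e \<in> E" "\<not> touches a e" using ac nac by (metis (no_types, lifting) Collect_cong Collect_mem_eq)
  obtain x where x: "x \<in> inner e" using inner_nonempty[OF e(1)] by blast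
  have xW: "x \<in> ?W"
    using x inner_not_vertex[OF e(1) x] inner_disjoint[OF e(1) H] e by blast
  have xF: "x \<notin> ?F"
    using x e(1) connected_component_subset[of "- X E" a] unfolding inner_def X_def by blast
  have "openin (top_of_set ?W) (?F \<inter> ?W)" using openin_open_Int[OF openF, of ?W] by (simp only: Int_commute)
  moreover have "closedin (top_of_set ?W) (?F \<inter> ?W)"
  proof -
    have "?W \<inter> ?F = ?W \<inter> closure ?F"
      by (rule equalityI[OF Int_mono[OF order_refl closure_subset]]) (use cl in blast)
    then show ?thesis
      using closedin_closed_Int[OF closed_closure, of ?W ?F] by (simp only: Int_commute[of ?F])
  qed
  ultimately have "?F \<inter> ?W = {} \<or> ?F \<inter> ?W = ?W"
    using \<open>connected ?W\<close> connected_clopen by blast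
  moreover have "?F \<inter> ?W \<noteq> {}"
  proof
    assume "?F \<inter> ?W = {}"
    then have "?F \<subseteq> f ` V"
      using connected_component_subset[of "- X E" a] X_mono[OF H] by blast
    then have "finite ?F" using finV finite_subset by blast
    then show False using openF aF finite_imp_not_open by blast
  qed
  ultimately show False using xW xF by blast
qed

end

section \<open>Counting faces, and sparsity from the girth\<close>

text \<open>The lower bound on the number of faces in Euler's formula, with one point of the set chosen in
  each face. Removing an edge that lies on a cycle merges the two faces on the two sides of the Jordan curve
  through that edge.\<close>

lemma faces_exist:
  assumes "drawing V E f I" "V \<noteq> {}"
  shows "\<exists>P. finite P \<and> P \<inter> drawing.X I E = {} \<and>
    (\<forall>a\<in>P. \<forall>b\<in>P. connected_component (- drawing.X I E) a b \<longrightarrow> a = b) \<and> card E + 2 \<le> card P + card V"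
  using assms(1)
proof (induction "card E" arbitrary: E rule: less_induct)
  case (less E)
  then interpret drawing V E f I by simp
  show ?case
  proof (cases "acyclic_edges E")
    case True
    have "card E + 1 \<le> card V"
      by (rule acyclic_edges_card[OF finV assms(2) finE _ True]) (use edge in blast)
    moreover obtain z where "z \<notin> X E"
      using compact_X[of E] not_bounded_UNIV compact_imp_bounded by (metis UNIV_eq_I order_refl)
    ultimately show ?thesis by (intro exI[of _ "{z}"]) auto
  next
    case False
    then obtain vs where "is_cycle (\<Union>E) E vs" unfolding acyclic_edges_def by blast
    then obtain u v where uv: "{u, v} \<in> E" "u \<noteq> v" "(u, v) \<in> {(x, y). {x, y} \<in> E - {{u, v}}}\<^sup>*"
      using cycle_edge_detour by metis
    let ?e = "{u, v}"
    let ?H = "E - {?e}"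
    have HE: "?H \<subseteq> E" by auto
    have "\<Union>?H \<subseteq> V" using edge by blast
    then have "drawing V ?H f I" by (rule restrict_drawing[OF order_refl HE])
    note IH = less.hyps[OF _ this]
    have "path_component (X ?H) (f u) (f v)"
      using reach_path_component[OF uv(3) HE uv(2)] .
    then obtain g where g: "simple_path g" "pathfinish g = pathstart g" "I ?e \<subseteq> path_image g"
      "path_image g \<subseteq> X E"
      using edge_on_curve[OF uv(1,2)] by metis
    have J: "inside (path_image g) \<inter> outside (path_image g) = {}"
      "frontier (inside (path_image g)) = path_image g" "frontier (outside (path_image g)) = path_image g"
      using Jordan_inside_outside[OF g(1,2)] by auto
    have off: "z \<notin> X E" if "z \<notin> X ?H" "z \<notin> path_image g" for z
      using that X_remove[OF uv(1)] g(3) by blast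
    have insoff: "inside (path_image g) \<inter> path_image g = {}" "outside (path_image g) \<inter> path_image g = {}"
      using inside_no_overlap outside_no_overlap by auto
    have near: "\<exists>z\<in>U. z \<in> S"
      if "open U" "y \<in> U" "y \<in> path_image g" "frontier S = path_image g" for U S y
    proof -
      have "y \<in> closure S" using that(3,4) unfolding frontier_def by blast
      then show ?thesis using that(1,2) by (metis Int_iff closure_iff_nhds_not_empty disjoint_iff subset_refl)
    qed
    have "card ?H < card E" by (rule psubset_card_mono) (use finE uv in auto)
    then obtain P where P: "finite P" "P \<inter> X ?H = {}"
      "\<forall>a\<in>P. \<forall>b\<in>P. connected_component (- X ?H) a b \<longrightarrow> a = b" "card ?H + 2 \<le> card P + card V"
      using IH by metis
    \<comment> \<open>A chosen point may lie on the deleted edge; it is then replaced by a point of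
      its component inside the curve.\<close>
    have "\<exists>q'. q' \<notin> X E \<and> connected_component (- X ?H) q q'" if "q \<in> P" for q
    proof (cases "q \<in> path_image g")
      case True
      let ?U = "connected_component_set (- X ?H) q"
      have "open ?U" "q \<in> ?U"
        using open_Compl_X[OF HE] open_connected_component that P(2) by auto
      then obtain z where z: "z \<in> ?U" "z \<in> inside (path_image g)"
        using near True J(2) by blast
      then have "z \<notin> X ?H" using connected_component_subset[of "- X ?H" q] by blast
      then show ?thesis using off z insoff by blast
    next
      case False
      then show ?thesis using off that P(2) connected_component_refl[of q "- X ?H"] by blast
    qed
    then obtain h where h: "\<And>q. q \<in> P \<Longrightarrow> h q \<notin> X E \<and> connected_component (- X ?H) q (h q)"
      by metis
    obtain x where x: "x \<in> inner ?e" using inner_nonempty[OF uv(1)] by blast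
    have xg: "x \<in> path_image g" using x g(3) unfolding inner_def by blast
    have "x \<in> - X ?H" using x inner_disjoint[OF uv(1) HE] by blast
    then obtain r where r: "r > 0" "ball x r \<subseteq> - X ?H"
      using open_Compl_X[OF HE] openE by blast
    \<comment> \<open>Both sides of the curve have \<open>x\<close> on their boundary, so a disc
      that avoids the other edges contains a point of each.\<close>
    obtain a where a: "a \<in> ball x r" "a \<in> inside (path_image g)"
      using near[OF open_ball _ xg J(2)] r(1) by (metis centre_in_ball)
    obtain b where b: "b \<in> ball x r" "b \<in> outside (path_image g)"
      using near[OF open_ball _ xg J(3)] r(1) by (metis centre_in_ball)
    have abX: "a \<notin> X E" "b \<notin> X E" using off a b r(2) insoff by blast+
    have ab: "connected_component (- X ?H) a b"
      using connected_componentI[OF _ r(2) a(1) b(1)] by simp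
    have nab: "\<not> connected_component (- X E) a b"
    proof
      assume "connected_component (- X E) a b"
      then have "connected_component (- path_image g) a b"
        using connected_component_of_subset g(4) by (metis Compl_anti_mono)
      then show False using inside_same_component a(2) b(2) J(1) by blast
    qed
    \<comment> \<open>The merged face loses its point, if it had one, and receives \<open>a\<close>
      and \<open>b\<close> instead, so the count grows by at least one.\<close>
    define P1 where "P1 = {q \<in> P. \<not> connected_component (- X ?H) q a}"
    define P' where "P' = insert a (insert b (h ` P1))"
    have fin1: "finite P1" "P1 \<subseteq> P" unfolding P1_def using P by auto
    have hsep: "q = q'" if "q \<in> P" "q' \<in> P" "connected_component (- X E) (h q) (h q')" for q q'
    proof -
      have "connected_component (- X ?H) (h q) (h q')" using cc_mono[OF that(3) HE] .
      then have "connected_component (- X ?H) q (h q')"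
        using connected_component_trans h[OF that(1)] by blast
      then have "connected_component (- X ?H) q q'"
        using connected_component_trans connected_component_sym h[OF that(2)] by blast
      then show ?thesis using P(3) that by blast
    qed
    have away: "\<not> connected_component (- X ?H) (h q) a" "\<not> connected_component (- X ?H) (h q) b" if "q \<in> P1" for q
    proof -
      have q: "connected_component (- X ?H) q (h q)" "\<not> connected_component (- X ?H) q a"
        using that h fin1 unfolding P1_def by auto
      then show "\<not> connected_component (- X ?H) (h q) a" using connected_component_trans by blast
      then show "\<not> connected_component (- X ?H) (h q) b"
        using connected_component_sym[OF ab] connected_component_trans by blast
    qed
    have cca: "connected_component (- X ?H) z a" if "z = a \<or> z = b" for z
      using that connected_component_sym[OF ab] connected_component_refl[of a "- X ?H"] abX(1) X_mono[OF HE]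
      by blast
    have sep: "s = t" if sP: "s \<in> P'" and tP: "t \<in> P'" and sE: "connected_component (- X E) s t" for s t
    proof -
      have st: "connected_component (- X ?H) s t" "connected_component (- X ?H) t s"
        using cc_mono[OF sE HE] connected_component_sym by blast+
consider q where "q \<in> P1" "s = h q" | "s = a \<or> s = b" using sP unfolding P'_def by blast
      then show ?thesis
      proof cases
        case 1
        have "\<not> (t = a \<or> t = b)" using away[OF 1(1)] st 1(2) by blast
        then obtain q' where q': "q' \<in> P1" "t = h q'" using tP unfolding P'_def by blast
        have "connected_component (- X E) (h q) (h q')" using sE 1 q' by simp
        then show ?thesis using hsep 1 q' fin1 by blast
      next
        case 2
        have "t \<notin> h ` P1" using away(1) st(2) cca[OF 2] connected_component_trans by blast
        then have "t = a \<or> t = b" using tP unfolding P'_def by blast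
        then show ?thesis using 2 nab sE connected_component_sym by blast
      qed
    qed
    have "card P \<le> card P1 + 1"
    proof -
      have "card (P - P1) \<le> 1"
      proof (rule card_le_Suc0_iff_eq[THEN iffD2, unfolded One_nat_def[symmetric]])
        show "\<forall>s\<in>P - P1. \<forall>t\<in>P - P1. s = t"
        proof (intro ballI)
          fix s t assume st: "s \<in> P - P1" "t \<in> P - P1"
          then have "connected_component (- X ?H) s a" "connected_component (- X ?H) a t"
            unfolding P1_def using connected_component_sym by blast+
          then show "s = t" using P(3) st connected_component_trans by blast
        qed
      qed (use P in auto)
      then show ?thesis using card_Un_le[of P1 "P - P1"] fin1 by (simp add: Un_absorb1)
    qed
    moreover have "card P' = card P1 + 2"
    proof -
      have "inj_on h P1"
      proof (rule inj_onI)
        fix q q' assume q: "q \<in> P1" "q' \<in> P1" "h q = h q'"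
        have "connected_component (- X E) (h q) (h q')"
          using q h[of q] fin1 by auto
        then show "q = q'" using hsep q fin1 by blast
      qed
      then have "card (h ` P1) = card P1" by (rule card_image)
      moreover have "a \<notin> h ` P1" "b \<notin> h ` P1" using away cca connected_component_sym by blast+
      moreover have "a \<noteq> b" using a b J(1) by blast
      ultimately show ?thesis using fin1 unfolding P'_def by simp
    qed
    moreover have "card E = card ?H + 1" using card.remove[OF finE uv(1)] by simp
    ultimately have "card E + 2 \<le> card P' + card V" using P(4) by linarith
    moreover have "P' \<inter> X E = {}" using abX h fin1 unfolding P'_def by blast
    moreover have "finite P'" using fin1 unfolding P'_def by simp
    ultimately show ?thesis using sep by blast
  qed
qed

text \<open>Double counting of faces and touched edges: at least 7 edges per face and at most 2
  faces per edge give \<open>7 * card P \<le> 2 * card E\<close>. With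
  \<open>card E + 2 \<le> card P + card V\<close> this yields
  \<open>5 * card E + 14 \<le> 7 * card V\<close>. A forest has fewer edges than vertices.\<close>

lemma (in drawing) sparse_of_girth:
  assumes "V \<noteq> {}" and girth: "\<And>vs. is_cycle V E vs \<Longrightarrow> 7 \<le> length vs"
  shows "5 * card E < 7 * card V"
proof (cases "acyclic_edges E")
  case True
  have "card E + 1 \<le> card V"
    by (rule acyclic_edges_card[OF finV assms(1) finE _ True]) (use edge in blast)
  then show ?thesis by linarith
next
  case False
  obtain P where P: "finite P" "P \<inter> X E = {}"
    "\<forall>a\<in>P. \<forall>b\<in>P. connected_component (- X E) a b \<longrightarrow> a = b" "card E + 2 \<le> card P + card V"
    using faces_exist[OF drawing_axioms assms(1)] by metis
  have seven: "7 \<le> card {e \<in> E. touches a e}" if a: "a \<in> P" for a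
  proof -
    let ?H = "{e \<in> E. touches a e}"
    have "\<not> acyclic_edges ?H" using face_touches_cycle[OF _ False] a P(2) by blast
    then obtain vs where vs: "is_cycle (\<Union>?H) ?H vs" unfolding acyclic_edges_def by blast
    have "is_cycle V E vs" by (rule is_cycle_mono[OF vs]) (use edge in auto)
    then have "7 \<le> length vs" by (rule girth)
    also have "\<dots> \<le> card ?H" by (rule length_cycle_le_card[OF vs]) (use finE in simp)
    finally show ?thesis .
  qed
  have two: "card {a \<in> P. touches a e} \<le> 2" if e: "e \<in> E" for e
  proof (rule ccontr)
    assume "\<not> ?thesis"
    then have "3 \<le> card {a \<in> P. touches a e}" by simp
    then obtain T where T: "T \<subseteq> {a \<in> P. touches a e}" "card T = 3"
      by (meson obtain_subset_with_card_n)
    then obtain a b c where abc: "T = {a, b, c}" "a \<noteq> b" "a \<noteq> c" "b \<noteq> c"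
      by (metis card_3_iff)
    then show False using edge_two_sides[OF e, of a b c] T(1) P(3) by blast
  qed
  have "7 * card P = (\<Sum>a\<in>P. 7)" by simp
  also have "\<dots> \<le> (\<Sum>a\<in>P. card {e \<in> E. touches a e})" by (rule sum_mono) (rule seven)
  also have "\<dots> = (\<Sum>a\<in>P. \<Sum>e\<in>E. if touches a e then 1 else 0)"
    using finE by (simp add: sum.If_cases Int_def)
  also have "\<dots> = (\<Sum>e\<in>E. \<Sum>a\<in>P. if touches a e then 1 else 0)" by (rule sum.swap)
  also have "\<dots> = (\<Sum>e\<in>E. card {a \<in> P. touches a e})"
    using P(1) by (simp add: sum.If_cases Int_def)
  also have "\<dots> \<le> (\<Sum>e\<in>E. 2)" by (rule sum_mono) (rule two)
  also have "\<dots> = 2 * card E" by simp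
  finally show ?thesis using P(4) by linarith
qed

text \<open>The continuous injective map \<open>\<phi>\<close> carries the drawing from pairs of
  reals to the complex plane.\<close>

lemma planar_imp_drawing:
  assumes "planar V E" "simple_graph V E"
  obtains f I where "drawing V E f I"
proof -
  from assms(1) obtain f :: "'a \<Rightarrow> real \<times> real" and p where f: "inj_on f V"
    and p: "\<forall>e\<in>E. arc (p e) \<and> (\<exists>u v. e = {u, v} \<and> pathstart (p e) = f u \<and> pathfinish (p e) = f v)"
    and avoid: "\<forall>e\<in>E. \<forall>w\<in>V - e. f w \<notin> path_image (p e)"
    and meet: "\<forall>e\<in>E. \<forall>e'\<in>E. e \<noteq> e' \<longrightarrow> path_image (p e) \<inter> path_image (p e') \<subseteq> f ` (e \<inter> e')"
    unfolding planar_def by (elim exE conjE)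
  define \<phi> where "\<phi> = (\<lambda>z. Complex (fst z) (snd z))"
  have inj: "inj_on \<phi> S" for S unfolding \<phi>_def by (auto intro!: inj_onI prod_eqI)
  have cont: "continuous_on S \<phi>" for S unfolding \<phi>_def by (intro continuous_intros)
  have arc: "arc (\<phi> \<circ> p e)" if "e \<in> E" for e
  proof -
    have "arc (p e)" using p that by blast
    then show ?thesis unfolding arc_def by (simp add: path_continuous_image cont comp_inj_on inj)
  qed
  have "drawing V E (\<phi> \<circ> f) (\<lambda>e. path_image (\<phi> \<circ> p e))"
  proof
    show "finite V" "\<And>e. e \<in> E \<Longrightarrow> e \<subseteq> V \<and> card e = 2"
      using assms(2) unfolding simple_graph_def by auto
    show "inj_on (\<phi> \<circ> f) V" using f inj by (rule comp_inj_on)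
    show "\<exists>g u v. arc g \<and> path_image g = path_image (\<phi> \<circ> p e) \<and> e = {u, v} \<and>
        pathstart g = (\<phi> \<circ> f) u \<and> pathfinish g = (\<phi> \<circ> f) v" if e: "e \<in> E" for e
    proof -
      obtain u v where "e = {u, v}" "pathstart (p e) = f u" "pathfinish (p e) = f v"
        using bspec[OF p e] by (elim exE conjE)
      then show ?thesis
        using arc[OF e] pathstart_compose[of \<phi> "p e"] pathfinish_compose[of \<phi> "p e"]
        by (intro exI[of _ "\<phi> \<circ> p e"] exI[of _ u] exI[of _ v] conjI) simp_all
    qed
    show "(\<phi> \<circ> f) w \<notin> path_image (\<phi> \<circ> p e)" if "e \<in> E" "w \<in> V - e" for e w
    proof -
      have "f w \<notin> path_image (p e)" using avoid that by blast
      then show ?thesis using inj_image_mem_iff[OF inj[of UNIV]] by (simp add: path_image_compose)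
    qed
    show "path_image (\<phi> \<circ> p e) \<inter> path_image (\<phi> \<circ> p e') \<subseteq> (\<phi> \<circ> f) ` (e \<inter> e')"
      if "e \<in> E" "e' \<in> E" "e \<noteq> e'" for e e'
    proof -
      have "path_image (\<phi> \<circ> p e) \<inter> path_image (\<phi> \<circ> p e') = \<phi> ` (path_image (p e) \<inter> path_image (p e'))"
        by (simp add: path_image_compose image_Int inj)
      also have "\<dots> \<subseteq> \<phi> ` f ` (e \<inter> e')" using meet that by (intro image_mono) blast
      finally show ?thesis by (simp add: image_comp)
    qed
  qed
  then show ?thesis using that by blast
qed

lemma planar_girth_7_sparse:
  assumes "planar V E" "simple_graph V E" "girth V E \<ge> 7"
    and sub: "V' \<subseteq> V" "V' \<noteq> {}" "E' \<subseteq> E" "\<Union>E' \<subseteq> V'"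
  shows "5 * card E' < 7 * card V'"
proof -
  obtain f I where "drawing V E f I" using planar_imp_drawing assms by blast
  then interpret D: drawing V' E' f I using drawing.restrict_drawing sub by metis
  show ?thesis
  proof (rule D.sparse_of_girth)
    fix vs assume "is_cycle V' E' vs"
    then have "is_cycle V E vs" using sub is_cycle_mono by metis
    then have "girth V E \<le> enat (length vs)" unfolding girth_def by (intro INF_lower) simp
    then show "7 \<le> length vs" using assms(3) by (metis enat_ord_simps(1) numeral_eq_enat order_trans)
  qed fact
qed

section \<open>Conflicts and greedy coloring\<close>

text \<open>A symmetric form of the condition in \<open>strong_edge_coloring\<close>. Edges with a
  common end are included: for \<open>e = {u, v}\<close> in \<open>E\<close> and
  \<open>v \<in> e'\<close> take \<open>x = u\<close> and \<open>y = v\<close>.\<close>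

definition conflict :: "'a set set \<Rightarrow> 'a set \<Rightarrow> 'a set \<Rightarrow> bool" where
  "conflict E e e' \<longleftrightarrow> e \<noteq> e' \<and> (\<exists>x\<in>e. \<exists>y\<in>e'. {x, y} \<in> E)"

lemma conflict_sym: "conflict E e e' \<Longrightarrow> conflict E e' e"
  unfolding conflict_def by (metis insert_commute)

lemma strong_edge_coloringI:
  assumes "\<And>e e'. e \<in> E \<Longrightarrow> e' \<in> E \<Longrightarrow> conflict E e e' \<Longrightarrow> c e \<noteq> c e'"
  shows "strong_edge_coloring E c"
  unfolding strong_edge_coloring_def
proof (intro ballI allI impI)
  fix e1 e2 u v
  assume e: "e1 \<in> E" "e2 \<in> E" "e1 = {u, v} \<and> e1 \<noteq> e2 \<and> e2 \<inter> (nbhd E u \<union> nbhd E v) \<noteq> {}"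
  then have "conflict E e1 e2" unfolding conflict_def nbhd_def by blast
  then show "c e1 \<noteq> c e2" using e assms by blast
qed

definition list_proper :: "('b \<Rightarrow> 'b \<Rightarrow> bool) \<Rightarrow> ('b \<Rightarrow> 'c set) \<Rightarrow> 'b set \<Rightarrow> ('b \<Rightarrow> 'c) \<Rightarrow> bool" where
  "list_proper R L A c \<longleftrightarrow> (\<forall>x\<in>A. c x \<in> L x) \<and> (\<forall>x\<in>A. \<forall>y\<in>A. R x y \<longrightarrow> c x \<noteq> c y)"

text \<open>Elements with fewer than \<open>n\<close> neighbours are stripped one after another.
  Going back, each sees fewer than \<open>n\<close> forbidden colors and has at least
  \<open>n\<close> in its list, so a coloring of the remaining set \<open>K\<close>, possibly empty,
  extends.\<close>

lemma greedy_core: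
  assumes "finite A" and sym: "\<And>x y. R x y \<Longrightarrow> R y x" and irr: "\<And>x. \<not> R x x"
    and L: "\<And>x. x \<in> A \<Longrightarrow> infinite (L x) \<or> n \<le> card (L x)"
  shows "\<exists>K\<subseteq>A. (\<forall>x\<in>K. n \<le> card {y \<in> K. R x y}) \<and>
      (\<forall>c. list_proper R L K c \<longrightarrow> (\<exists>c'. list_proper R L A c'))"
  using assms(1) L
  proof (induction "card A" arbitrary: A rule: less_induct)
    case less
    show ?case
    proof (cases "\<forall>x\<in>A. n \<le> card {y \<in> A. R x y}")
      case True
      then show ?thesis by blast
    next
      case False
      then obtain x where x: "x \<in> A" "card {y \<in> A. R x y} < n" by force
      have "card (A - {x}) < card A" using less.prems(1) x(1) by (rule card_Diff1_less)
      then obtain K where K: "K \<subseteq> A - {x}" "\<forall>x\<in>K. n \<le> card {y \<in> K. R x y}"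
        "\<forall>c. list_proper R L K c \<longrightarrow> (\<exists>c'. list_proper R L (A - {x}) c')"
        using less.hyps[of "A - {x}"] less.prems by auto
      have extend: "\<exists>c'. list_proper R L A c'" if c: "list_proper R L (A - {x}) c" for c
      proof -
        let ?B = "c ` {y \<in> A. R x y}"
        have fin: "finite {y \<in> A. R x y}" using less.prems(1) by simp
        have lt: "card ?B < n" using card_image_le[OF fin, of c] x(2) by linarith
        have "\<not> L x \<subseteq> ?B"
        proof
          assume sub: "L x \<subseteq> ?B"
          then have "finite (L x)" "card (L x) \<le> card ?B"
            using fin finite_subset card_mono by blast+
          then show False using less.prems(2)[OF x(1)] lt by linarith
        qed
        then obtain z where z: "z \<in> L x" "z \<notin> ?B" by blast
        have "list_proper R L A (c(x := z))"
          unfolding list_proper_def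
        proof (intro conjI ballI impI)
          fix y assume "y \<in> A"
          then show "(c(x := z)) y \<in> L y" using c z(1) unfolding list_proper_def by simp
        next
          fix s t assume st: "s \<in> A" "t \<in> A" "R s t"
          have zc: "z \<noteq> c y" if "y \<in> A" "R x y" for y using z(2) that by blast
          show "(c(x := z)) s \<noteq> (c(x := z)) t"
          proof (cases "s = x \<or> t = x")
            case True
            then show ?thesis using zc[of s] zc[of t] st sym[of s t] irr[of x]
              by (metis fun_upd_other fun_upd_same)
          next
            case False
            then show ?thesis using c st unfolding list_proper_def by simp
          qed
        qed
        then show ?thesis by blast
      qed
      have "K \<subseteq> A" using K(1) by blast
      moreover have "\<forall>c. list_proper R L K c \<longrightarrow> (\<exists>c'. list_proper R L A c')"
        using K(3) extend by metis
      ultimately show ?thesis using K(2) by (intro exI[of _ K] conjI)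
    qed
  qed

section \<open>Discharging\<close>

text \<open>The configuration left when no vertex with an incident edge avoids the core
  \<open>K\<close>. For nonempty \<open>E\<close> it is incompatible with sparsity, by
  \<open>dense\<close> and \<open>V2_nonempty\<close>.\<close>

locale core_graph =
  fixes V :: "'a set" and E K :: "'a set set" and D :: nat
  assumes D4: "4 \<le> D"
    and simple: "simple_graph V E"
    and deg_le: "\<And>v. v \<in> V \<Longrightarrow> degree E v \<le> D"
    and KE: "K \<subseteq> E"
    and heavy: "\<And>e. e \<in> K \<Longrightarrow> 3 * D \<le> card {e' \<in> K. conflict E e e'}"
    and cover: "\<And>e v. e \<in> E \<Longrightarrow> v \<in> e \<Longrightarrow> \<exists>e'\<in>K. v \<in> e'"
begin

abbreviation N :: "'a \<Rightarrow> 'a set" where "N \<equiv> nbhd E"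
abbreviation d :: "'a \<Rightarrow> nat" where "d u \<equiv> card (nbhd E u)"
abbreviation dK :: "'a \<Rightarrow> nat" where "dK u \<equiv> card (nbhd K u)"

definition leaves :: "'a \<Rightarrow> 'a set" where "leaves u = {w \<in> N u. d w = 1}"
definition twos :: "'a \<Rightarrow> 'a set" where "twos u = {w \<in> N u. d w = 2}"
definition bigs :: "'a \<Rightarrow> 'a set" where "bigs u = {w \<in> N u. 3 \<le> d w}"

text \<open>The degree of a vertex after deletion of all leaves of the graph.\<close>

definition k :: "'a \<Rightarrow> nat" where "k u = card (twos u) + card (bigs u)"

lemma finV: "finite V" and edge: "e \<in> E \<Longrightarrow> e \<subseteq> V \<and> card e = 2"
  using simple unfolding simple_graph_def by auto

lemma finE: "finite E"
  by (rule finite_subset[of _ "Pow V"]) (use finV edge in auto)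

lemma in_N: "w \<in> N u \<longleftrightarrow> {u, w} \<in> E"
  unfolding nbhd_def by simp

lemma in_NK: "w \<in> nbhd K u \<longleftrightarrow> {u, w} \<in> K"
  unfolding nbhd_def by simp

lemma N_sym: "w \<in> N u \<longleftrightarrow> u \<in> N w"
  by (simp add: in_N insert_commute)

lemma N_V: "w \<in> N u \<Longrightarrow> u \<in> V \<and> w \<in> V \<and> u \<noteq> w"
  using edge[of "{u, w}"] by (auto simp: in_N)

lemma finN: "finite (N u)"
  using N_V finV by (metis finite_subset subsetI)

lemma NK_sub: "nbhd K u \<subseteq> N u"
  using KE unfolding nbhd_def by auto

lemma finNK: "finite (nbhd K u)"
  using finite_subset[OF NK_sub finN] .

lemma dK_le_d: "dK u \<le> d u"
  by (rule card_mono[OF finN NK_sub])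

lemma d_le_D: "d u \<le> D"
proof (cases "N u = {}")
  case False
  then have u: "u \<in> V" using N_V by blast
  have "d u \<le> degree E u"
    unfolding degree_def
  proof (rule card_inj_on_le)
    show "inj_on (\<lambda>w. {u, w}) (N u)" by (rule inj_onI) (metis doubleton_eq_iff)
  qed (use finE in \<open>auto simp: in_N\<close>)
  then show ?thesis using deg_le[OF u] by linarith
qed simp

lemma dK_le_D: "dK u \<le> D"
  using dK_le_d d_le_D le_trans by blast

lemma d_pos: "w \<in> N u \<Longrightarrow> 1 \<le> d w"
  using N_sym[of w u] finN[of w] by (auto simp: Suc_le_eq card_gt_0_iff)

lemma dK_pos: "w \<in> N u \<Longrightarrow> 1 \<le> dK w"
proof -
  assume "w \<in> N u"
  then obtain e where e: "e \<in> K" "w \<in> e" using cover[of "{u, w}" w] by (auto simp: in_N)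
  then obtain x y where "e = {x, y}" using edge[of e] KE by (metis card_2_iff subsetD)
  then have "nbhd K w \<noteq> {}" using e unfolding nbhd_def by (auto simp: insert_commute)
  then show ?thesis using finNK card_gt_0_iff by (metis One_nat_def Suc_leI)
qed

text \<open>An edge of \<open>K\<close> in conflict with \<open>{u, v}\<close> has an end among the
  neighbours of \<open>u\<close> other than \<open>v\<close> or of \<open>v\<close> other than
  \<open>u\<close>, so the \<open>K\<close>-degrees of these vertices count all conflicts.\<close>

lemma conflict_count:
  assumes "{u, v} \<in> K"
  shows "3 * D \<le> (\<Sum>x\<in>N u - {v}. dK x) + (\<Sum>x\<in>N v - {u}. dK x)"
proof -
  let ?B = "\<lambda>x. (\<lambda>z. {x, z}) ` nbhd K x"
  have "{e' \<in> K. conflict E {u, v} e'} \<subseteq> (\<Union>x\<in>N u - {v}. ?B x) \<union> (\<Union>x\<in>N v - {u}. ?B x)"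
  proof
    fix e' assume "e' \<in> {e' \<in> K. conflict E {u, v} e'}"
    then have e': "e' \<in> K" "e' \<noteq> {u, v}" and "\<exists>x\<in>{u, v}. \<exists>y\<in>e'. {x, y} \<in> E"
      unfolding conflict_def by auto
    then obtain x y where xy: "x = u \<or> x = v" "y \<in> e'" "y \<in> N x" unfolding in_N by blast
    obtain s t where st: "e' = {s, t}" using e'(1) edge KE by (metis card_2_iff subsetD)
    obtain z where z: "e' = {y, z}" using st xy(2) by (metis insert_commute insert_iff singletonD)
    have zy: "z \<in> nbhd K y" "y \<in> nbhd K z" using e'(1) z by (auto simp: in_NK insert_commute)
    have yz: "y \<in> N z" "z \<in> N y" using zy NK_sub by blast+
    have m1: "e' \<in> ?B y" "e' \<in> ?B z" using z zy by (auto simp: insert_commute)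
    \<comment> \<open>The vertex \<open>y\<close> serves unless it is an end of
      \<open>{u, v}\<close>; in that case the other end \<open>z\<close> of the edge serves.\<close>
    show "e' \<in> (\<Union>x\<in>N u - {v}. ?B x) \<union> (\<Union>x\<in>N v - {u}. ?B x)"
    proof (cases "x = u")
      case True
      then show ?thesis
      proof (cases "y = v")
        case True
        then have "z \<in> N v - {u}" using e'(2) z yz by (auto simp: insert_commute)
        then show ?thesis using m1(2) by blast
      next
        case False
        then have "y \<in> N u - {v}" using True xy by simp
        then show ?thesis using m1(1) by blast
      qed
    next
      case False
      then have x: "x = v" using xy by simp
      show ?thesis
      proof (cases "y = u")
        case True
        then have "z \<in> N u - {v}" using e'(2) z yz by (auto simp: insert_commute)
        then show ?thesis using m1(2) by blast
      next
        case False
        then have "y \<in> N v - {u}" using x xy by simp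
        then show ?thesis using m1(1) by blast
      qed
    qed
  qed
  then have "card {e' \<in> K. conflict E {u, v} e'} \<le> card ((\<Union>x\<in>N u - {v}. ?B x) \<union> (\<Union>x\<in>N v - {u}. ?B x))"
    by (rule card_mono[rotated]) (use finN finNK in simp)
  also have "\<dots> \<le> card (\<Union>x\<in>N u - {v}. ?B x) + card (\<Union>x\<in>N v - {u}. ?B x)" by (rule card_Un_le)
  also have "\<dots> \<le> (\<Sum>x\<in>N u - {v}. dK x) + (\<Sum>x\<in>N v - {u}. dK x)"
  proof (rule add_mono)
    show "card (\<Union>x\<in>N a - {b}. ?B x) \<le> (\<Sum>x\<in>N a - {b}. dK x)" for a b
    proof -
      have "card (\<Union>x\<in>N a - {b}. ?B x) \<le> (\<Sum>x\<in>N a - {b}. card (?B x))"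
        by (rule card_UN_le) (use finN in simp)
      also have "\<dots> \<le> (\<Sum>x\<in>N a - {b}. dK x)" by (intro sum_mono card_image_le finNK)
      finally show ?thesis .
    qed
    then show "card (\<Union>x\<in>N v - {u}. ?B x) \<le> (\<Sum>x\<in>N v - {u}. dK x)" .
  qed
  finally show ?thesis using heavy[OF assms] by linarith
qed

section \<open>Neighbourhoods forced by core edges at vertices of degree 1 and 2\<close>

lemma N_partition:
  "N u = leaves u \<union> twos u \<union> bigs u" "leaves u \<inter> twos u = {}" "(leaves u \<union> twos u) \<inter> bigs u = {}"
proof -
  have "d w = 1 \<or> d w = 2 \<or> 3 \<le> d w" if "w \<in> N u" for w using d_pos[OF that] by linarith
  then show "N u = leaves u \<union> twos u \<union> bigs u" unfolding leaves_def twos_def bigs_def by blast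
qed (auto simp: leaves_def twos_def bigs_def)

lemma fin_parts: "finite (leaves u)" "finite (twos u)" "finite (bigs u)"
  using finN unfolding leaves_def twos_def bigs_def by auto

lemma d_eq: "d u = card (leaves u) + k u"
  unfolding k_def using N_partition[of u] fin_parts[of u] by (simp add: card_Un_disjoint)

lemma sum_N: "(\<Sum>x\<in>N u. dK x) = (\<Sum>x\<in>leaves u. dK x) + (\<Sum>x\<in>twos u. dK x) + (\<Sum>x\<in>bigs u. dK x)"
  using N_partition[of u] fin_parts[of u] by (simp add: sum.union_disjoint)

lemma sum_leaves: "(\<Sum>x\<in>leaves u. dK x) \<le> card (leaves u)"
proof -
  have "dK x \<le> 1" if "x \<in> leaves u" for x using dK_le_d[of x] that unfolding leaves_def by simp
  then show ?thesis using sum_bounded_above[of "leaves u" dK 1] by simp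
qed

lemma sum_bigs: "(\<Sum>x\<in>bigs u. dK x) \<le> card (bigs u) * D"
  using sum_bounded_above[of "bigs u" dK D] dK_le_D by simp

lemma sum_twos: "A \<subseteq> twos u \<Longrightarrow> (\<Sum>x\<in>A. dK x) \<le> 2 * card A"
proof -
  assume A: "A \<subseteq> twos u"
  have "dK x \<le> 2" if "x \<in> A" for x using dK_le_d[of x] that A unfolding twos_def by auto
  then show ?thesis using sum_bounded_above[of A dK 2] by simp
qed

lemma sum_N_remove: "v \<in> N u \<Longrightarrow> (\<Sum>x\<in>N u - {v}. dK x) + dK v = (\<Sum>x\<in>N u. dK x)"
  using sum.remove[OF finN, of v u dK] by simp

text \<open>Every leaf edge lies in \<open>K\<close>, because its leaf is covered.\<close>

lemma leaf_bound:
  assumes "leaves u \<noteq> {}"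
  shows "3 * D + 1 \<le> card (leaves u) + 2 * card (twos u) + card (bigs u) * D"
proof -
  obtain v where v: "v \<in> N u" "d v = 1" using assms unfolding leaves_def by blast
  have Nv: "N v = {u}" using v N_sym[of v u] by (auto simp: card_1_singleton_iff)
  have "nbhd K v \<noteq> {}" using dK_pos[OF v(1)] by auto
  then have "nbhd K v = {u}" using NK_sub[of v] Nv by auto
  then have K: "{u, v} \<in> K" "dK v = 1" using in_NK[of u v] by (simp_all add: insert_commute)
  have "3 * D \<le> (\<Sum>x\<in>N u - {v}. dK x)"
    using conflict_count[OF K(1)] Nv by simp
  then have "3 * D + 1 \<le> (\<Sum>x\<in>N u. dK x)" using sum_N_remove[OF v(1)] K(2) by linarith
  then show ?thesis
    using sum_N[of u] sum_leaves[of u] sum_bigs[of u] sum_twos[OF order_refl, of u] by linarith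
qed

text \<open>Apart from \<open>u\<close>, the only neighbour of \<open>v\<close> is \<open>w\<close>,
  so its side of the conflict count is \<open>dK w\<close>. At \<open>u\<close>, a leaf counts at
  most 1 and a neighbour of degree at least 3 at most \<open>D\<close>.\<close>

lemma two_bound:
  assumes "{u, v} \<in> K" "v \<in> twos u" "N v = {u, w}" "u \<noteq> w"
  shows "3 * D \<le> card (leaves u) + (\<Sum>x\<in>twos u - {v}. dK x) + card (bigs u) * D + dK w"
proof -
  have v: "v \<in> N u" using assms(2) unfolding twos_def by simp
  have "N v - {u} = {w}" using assms(3,4) by auto
  then have "3 * D + dK v \<le> (\<Sum>x\<in>N u. dK x) + dK w"
    using conflict_count[OF assms(1)] sum_N_remove[OF v] by simp
  moreover have "(\<Sum>x\<in>twos u. dK x) = dK v + (\<Sum>x\<in>twos u - {v}. dK x)"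
    by (rule sum.remove[OF fin_parts(2) assms(2)])
  ultimately show ?thesis using sum_N[of u] sum_leaves[of u] sum_bigs[of u] by linarith
qed

lemma two_bound':
  assumes "{u, v} \<in> K" "v \<in> twos u" "N v = {u, w}" "u \<noteq> w"
  shows "3 * D + 2 \<le> card (leaves u) + 2 * card (twos u) + card (bigs u) * D + dK w"
proof -
  have "(\<Sum>x\<in>twos u - {v}. dK x) \<le> 2 * card (twos u - {v})" by (rule sum_twos) blast
  moreover have "card (twos u) = card (twos u - {v}) + 1"
    using card.remove[OF fin_parts(2) assms(2)] by simp
  ultimately show ?thesis using two_bound[OF assms] by linarith
qed

lemma size_bound: "card (leaves u) + card (twos u) + card (bigs u) \<le> D"
  using d_eq[of u] d_le_D[of u] unfolding k_def by linarith

text \<open>Since \<open>u\<close> has at most \<open>D\<close> neighbours,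
  \<open>leaf_bound\<close> fails with at most one neighbour of degree at least 3, and with exactly
  two it needs three neighbours of degree 2.\<close>

lemma leaf_cases:
  assumes "leaves u \<noteq> {}"
  shows "3 \<le> card (bigs u) \<or> (card (bigs u) = 2 \<and> 3 \<le> card (twos u))"
proof -
  have l: "1 \<le> card (leaves u)" using assms fin_parts by (simp add: Suc_leI card_gt_0_iff)
  consider "card (bigs u) = 0" | "card (bigs u) = 1" | "card (bigs u) = 2" | "3 \<le> card (bigs u)"
    by linarith
  then show ?thesis
    by cases (use leaf_bound[OF assms] size_bound[of u] D4 l in auto)
qed

text \<open>By \<open>leaf_cases\<close> a vertex with a leaf neighbour keeps at least three other
  neighbours; without leaf neighbours \<open>k u = d u\<close>.\<close>

lemma k_ge_3: "3 \<le> d u \<Longrightarrow> 3 \<le> k u"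
  and k_eq_2: "d u = 2 \<Longrightarrow> leaves u = {} \<and> k u = 2"
  using leaf_cases[of u] d_eq[of u] unfolding k_def by (cases "leaves u = {}"; auto)+

lemma k3_no_leaf:
  assumes "k u = 3" "twos u \<noteq> {}" shows "leaves u = {}" "d u = 3"
proof -
  have "1 \<le> card (twos u)" using assms(2) fin_parts by (simp add: Suc_leI card_gt_0_iff)
  then show "leaves u = {}" using leaf_cases[of u] assms(1) unfolding k_def by (cases "leaves u = {}") auto
  then show "d u = 3" using d_eq[of u] assms(1) by simp
qed

text \<open>All parts compare \<open>two_bound'\<close> with \<open>dK w \<le> D\<close> and the at
  most \<open>D\<close> neighbours of \<open>u\<close>. For \<open>k u = 3\<close> there are no
  leaves, one neighbour of degree 2 and two larger ones, and the bound leaves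
  \<open>D \<le> dK w\<close>.\<close>

lemma K_two_cases:
  assumes "{u, v} \<in> K" "v \<in> twos u" "N v = {u, w}" "u \<noteq> w"
  shows "1 \<le> card (bigs u)" "card (bigs u) = 1 \<Longrightarrow> 4 \<le> k u \<and> 4 \<le> dK w"
    "3 \<le> k u" "k u = 3 \<Longrightarrow> card (twos u) = 1 \<and> dK w = D"
proof -
  note b = two_bound'[OF assms] and s = size_bound[of u] and w = dK_le_D[of w]
  have t: "1 \<le> card (twos u)" using assms(2) fin_parts by (metis One_nat_def Suc_leI card_gt_0_iff empty_iff)
  show b1: "1 \<le> card (bigs u)"
  proof (rule ccontr)
    assume "\<not> ?thesis"
    then have "card (bigs u) = 0" by simp
    then show False using b s w D4 by simp
  qed
  show b2: "4 \<le> k u \<and> 4 \<le> dK w" if "card (bigs u) = 1"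
    using b s w D4 that unfolding k_def by simp
  show "3 \<le> k u" using b1 b2 t unfolding k_def by linarith
  show "card (twos u) = 1 \<and> dK w = D" if k3: "k u = 3"
  proof -
    have "card (twos u) = 1" "card (bigs u) = 2" using b1 b2 t k3 unfolding k_def by linarith+
    moreover have "leaves u = {}" using k3_no_leaf(1)[OF k3] assms(2) by blast
    ultimately show ?thesis using b w by simp
  qed
qed

section \<open>The discharging rule and its local consequences\<close>

definition other :: "'a \<Rightarrow> 'a \<Rightarrow> 'a" where "other u v = (SOME w. w \<in> N v - {u})"

text \<open>In units of 1/5, a vertex has charge \<open>5 k - 14\<close>, so a vertex of degree 2 lacks 4 units. The function
  \<open>gift u v\<close> is the charge that a vertex \<open>u\<close> sends to its neighbour \<open>v\<close> of degree 2, whose other neighbour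
  is \<open>other u v\<close>; only the values at such pairs matter.\<close>

definition gift :: "'a \<Rightarrow> 'a \<Rightarrow> nat" where
  "gift u v = (let w = other u v in
     if {u, v} \<notin> K then (if dK u \<le> 1 then 0 else if k u = 3 then 1 else 2)
     else if {w, v} \<notin> K then (if dK w \<le> 1 then 4 else if k w = 3 then 3 else 2)
     else if k u = 3 then 1 else if k w = 3 then 3 else 2)"

lemma other:
  assumes "v \<in> twos u"
  shows "N v = {u, other u v}" "u \<noteq> other u v" "v \<in> twos (other u v)" "other (other u v) v = u"
proof -
  have v: "u \<in> N v" "d v = 2" using assms N_sym[of v u] unfolding twos_def by auto
  then obtain w where w: "N v = {u, w}" "w \<noteq> u"
    by (metis card_2_iff doubleton_eq_iff insertE singletonD)
  have o: "other u v = w" unfolding other_def w(1) using w(2) by (intro some_equality) auto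
  have o': "other w v = u" unfolding other_def w(1) using w(2) by (intro some_equality) auto
  show "N v = {u, other u v}" "u \<noteq> other u v" "other (other u v) v = u" using w o o' by auto
  show "v \<in> twos (other u v)" using w(1) v(2) N_sym[of v w] unfolding o twos_def by simp
qed

lemma two_covered:
  assumes "v \<in> twos u"
  shows "{u, v} \<in> K \<or> {other u v, v} \<in> K"
proof -
  have "1 \<le> dK v" using assms dK_pos[of v u] unfolding twos_def by simp
  then have "nbhd K v \<noteq> {}" by auto
  then obtain x where "x \<in> nbhd K v" by blast
  then show ?thesis using NK_sub[of v] other(1)[OF assms] by (auto simp: in_NK insert_commute)
qed

lemma two_dK_eq_2:
  assumes "v \<in> twos u" "2 \<le> dK v"
  shows "{u, v} \<in> K" "{other u v, v} \<in> K"
proof -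
  have "d v = 2" using assms(1) unfolding twos_def by simp
  then have "nbhd K v = N v" using assms(2) by (intro card_seteq finN NK_sub) simp
  then show "{u, v} \<in> K" "{other u v, v} \<in> K"
    using other(1)[OF assms(1)] in_NK[of u v] in_NK[of "other u v" v] by (simp_all add: insert_commute)
qed

lemma saturated_edge: "dK w = D \<Longrightarrow> v \<in> N w \<Longrightarrow> {w, v} \<in> K"
proof -
  assume "dK w = D" "v \<in> N w"
  then have "nbhd K w = N w" using d_le_D[of w] by (intro card_seteq finN NK_sub) simp
  then show ?thesis using \<open>v \<in> N w\<close> in_NK by blast
qed

lemma other_k_ne_3:
  assumes "v \<in> twos w" "4 \<le> dK w" shows "k w \<noteq> 3"
  using k3_no_leaf(2)[of w] assms dK_le_d[of w] by force

lemma gift_le: "gift u v \<le> 4"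
  unfolding gift_def Let_def by simp

text \<open>The rule gives complementary values: 0 and 4, 1 and 3, or 2 and 2. With both edges in
  \<open>K\<close>, the clash of \<open>k = 3\<close> on both sides is excluded, because it would
  force \<open>dK = D \<ge> 4\<close> at a vertex of degree 3.\<close>

lemma gift_pair:
  assumes "v \<in> twos u" shows "gift u v + gift (other u v) v = 4"
proof -
  let ?w = "other u v"
  note o = other[OF assms]
  have Nv': "N v = {?w, u}" using o(1) by blast
  have clash: "\<not> (k u = 3 \<and> k ?w = 3)" if "{u, v} \<in> K" "{?w, v} \<in> K"
  proof
    assume "k u = 3 \<and> k ?w = 3"
    then show False
      using K_two_cases(4)[OF that(1) assms o(1,2)] other_k_ne_3[OF o(3)] D4 by simp
  qed
  show ?thesis
    using two_covered[OF assms] clash unfolding gift_def Let_def o(4) by auto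
qed

text \<open>An edge \<open>{u, v}\<close> in \<open>K\<close> would require
  \<open>k u \<ge> 3\<close>. Hence \<open>dK u \<le> 1\<close>, and a vertex that itself lacks
  charge sends nothing.\<close>

lemma gift_of_two:
  assumes "d u = 2" "v \<in> twos u" shows "gift u v = 0"
proof -
  have nK: "{u, v} \<notin> K"
    using K_two_cases(3)[OF _ assms(2) other(1,2)[OF assms(2)]] k_eq_2[OF assms(1)] by auto
  have "v \<in> N u" using assms(2) unfolding twos_def by simp
  then have "nbhd K u \<subseteq> N u - {v}" using NK_sub[of u] nK in_NK by blast
  then have "dK u \<le> card (N u - {v})" using finN by (intro card_mono) auto
  also have "\<dots> = 1" using assms(1) \<open>v \<in> N u\<close> finN by simp
  finally show ?thesis using nK unfolding gift_def by simp
qed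

text \<open>A gift above 2 needs \<open>{u, v}\<close> in \<open>K\<close> and a partner with
  \<open>k = 3\<close> or \<open>dK \<le> 1\<close>; here the partner has \<open>dK \<ge> 4\<close>,
  which excludes both.\<close>

lemma gift_le_2:
  assumes "v \<in> twos u" "card (bigs u) = 1" shows "gift u v \<le> 2"
proof (cases "{u, v} \<in> K")
  case True
  have "4 \<le> dK (other u v)" using K_two_cases(2)[OF True assms(1) other(1,2)[OF assms(1)] assms(2)] by simp
  then show ?thesis
    using True other_k_ne_3[OF other(3)[OF assms(1)]] unfolding gift_def Let_def by simp
next
  case False
  then show ?thesis unfolding gift_def Let_def by simp
qed

lemma gift_4:
  assumes "3 < gift u v"
  shows "{u, v} \<in> K" "dK (other u v) \<le> 1"
  using assms unfolding gift_def Let_def by (auto split: if_splits)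

lemma gift_le_3:
  assumes "v \<in> twos u" "2 \<le> dK v" shows "gift u v \<le> 3"
  using two_dK_eq_2[OF assms] unfolding gift_def Let_def by simp

text \<open>If \<open>{u, v}\<close> is in \<open>K\<close>, the other neighbour of \<open>v\<close>
  has \<open>dK = D\<close>, so all its edges are in \<open>K\<close> and no gift of 4
  arises.\<close>

lemma gift_le_1:
  assumes "k u = 3" "v \<in> twos u" shows "gift u v \<le> 1"
proof (cases "{u, v} \<in> K")
  case True
  note o = other[OF assms(2)]
  have "dK (other u v) = D" using K_two_cases(4)[OF True assms(2) o(1,2) assms(1)] by simp
  then have "{other u v, v} \<in> K" using saturated_edge o(3) unfolding twos_def by simp
  then show ?thesis using True assms(1) unfolding gift_def Let_def by simp
next
  case False
  then show ?thesis using assms(1) unfolding gift_def Let_def by simp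
qed

lemma sum_gift_bound:
  assumes "\<And>v. v \<in> twos u \<Longrightarrow> gift u v \<le> c"
  shows "(\<Sum>v\<in>twos u. gift u v) \<le> c * card (twos u)"
  using sum_bounded_above[of "twos u" "gift u" c] assms by (simp add: mult.commute)

lemma gifts_le_charge:
  assumes "3 \<le> d u" shows "(\<Sum>v\<in>twos u. gift u v) + 14 \<le> 5 * k u"
proof -
  let ?G = "\<Sum>v\<in>twos u. gift u v" and ?t = "card (twos u)" and ?b = "card (bigs u)"
  have k: "k u = ?t + ?b" unfolding k_def by simp
  have k3: "3 \<le> k u" using k_ge_3[OF assms] .
  have K_case: "1 \<le> ?b" "?b = 1 \<Longrightarrow> 4 \<le> k u" "k u = 3 \<Longrightarrow> ?t = 1" if "v \<in> twos u" "{u, v} \<in> K" for v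
    using K_two_cases[OF that(2,1) other(1,2)[OF that(1)]] by blast+
  have noK: "dK u \<le> card (leaves u) + ?b" if "\<forall>v\<in>twos u. {u, v} \<notin> K"
  proof -
    have "nbhd K u \<subseteq> leaves u \<union> bigs u"
      using NK_sub[of u] N_partition(1)[of u] that in_NK by blast
    then have "dK u \<le> card (leaves u \<union> bigs u)" using fin_parts by (intro card_mono) auto
    then show ?thesis using card_Un_le[of "leaves u" "bigs u"] by linarith
  qed
  have small: "?G = 0" if "\<forall>v\<in>twos u. {u, v} \<notin> K" "dK u \<le> 1"
    using that unfolding gift_def Let_def by simp
  \<comment> \<open>With \<open>?b = 0\<close> nothing is sent; with \<open>k u = 3\<close> one unit
    is spare; with \<open>?b = 1\<close> gifts of at most 2 are affordable from
    \<open>k u = 4\<close> on.\<close>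
  consider "?b = 0" | "k u = 3" "1 \<le> ?b" | "4 \<le> k u" "?b = 1" | "4 \<le> k u" "2 \<le> ?b"
    using k3 by linarith
  then show ?thesis
  proof cases
    case 1
    then have nK: "\<forall>v\<in>twos u. {u, v} \<notin> K" using K_case(1) by force
    have "leaves u = {}" using leaf_cases[of u] 1 by auto
    then have "dK u \<le> 1" using noK[OF nK] 1 by simp
    then show ?thesis using small[OF nK] k3 by linarith
  next
    case 2
    have G: "?G \<le> 1 * ?t" by (rule sum_gift_bound) (rule gift_le_1[OF 2(1)])
    have "?G \<le> 1"
    proof (cases "\<exists>v\<in>twos u. {u, v} \<in> K")
      case True
      then have "?t = 1" using K_case(3) 2(1) by blast
      then show ?thesis using G by simp
    next
      case nK: False
      show ?thesis
      proof (cases "?t \<le> 1")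
        case False
        then have "leaves u = {}" using k3_no_leaf(1)[OF 2(1)] by fastforce
        then have "dK u \<le> 1" using noK nK False 2(1) k by simp
        then show ?thesis using small nK by simp
      qed (use G in simp)
    qed
    then show ?thesis using 2(1) by simp
  next
    case 3
    have "?G \<le> 2 * ?t" by (rule sum_gift_bound) (rule gift_le_2[OF _ 3(2)])
    then show ?thesis using 3 k by linarith
  next
    case 4
    have G4: "?G \<le> 4 * ?t" by (rule sum_gift_bound) (rule gift_le)
    \<comment> \<open>Gifts of 4 to all neighbours of degree 2 are affordable except in the last two
      cases.\<close>
    consider "6 \<le> k u" | "k u = 4" "?t \<le> 1" | "k u = 5" "?t \<le> 2" | "k u = 4" "?t = 2" "?b = 2"
      | "k u = 5" "?t = 3" "?b = 2"
      using 4 k by linarith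
    then show ?thesis
    proof cases
      case 4
      have s: "card (leaves u) + 4 \<le> D" using size_bound[of u] 4 by linarith
      have "gift u v \<le> 3" if v: "v \<in> twos u" for v
      proof (rule ccontr)
        assume "\<not> ?thesis"
        then have "{u, v} \<in> K" "dK (other u v) \<le> 1" using gift_4[of u v] by auto
        then show False using two_bound'[OF _ v other(1,2)[OF v]] s 4 by simp
      qed
      then have "?G \<le> 3 * ?t" by (rule sum_gift_bound)
      then show ?thesis using 4 by simp
    next
      case 5
      have s: "card (leaves u) + 5 \<le> D" using size_bound[of u] 5 by linarith
      have "?G \<le> 10"
      proof (cases "\<exists>v\<in>twos u. 3 < gift u v")
        case False
        then have "?G \<le> 3 * ?t" by (intro sum_gift_bound) force
        then show ?thesis using 5 by simp
      next
        case True
        then obtain v where v: "v \<in> twos u" "3 < gift u v" by blast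
        have c: "card (twos u - {v}) = 2" using v(1) 5(2) fin_parts by simp
        then obtain x y where xy: "twos u - {v} = {x, y}" "x \<noteq> y" by (meson card_2_iff)
        have xt: "x \<in> twos u" "y \<in> twos u" using xy(1) by blast+
        \<comment> \<open>A gift of 4 to \<open>v\<close> forces \<open>dK x = dK y = 2\<close>, so
          \<open>x\<close> and \<open>y\<close> receive at most 3 each: in total at most 10 of the
          11 spare units.\<close>
        have "3 * D \<le> card (leaves u) + (dK x + dK y) + 2 * D + dK (other u v)"
          using two_bound[OF gift_4(1)[OF v(2)] v(1) other(1,2)[OF v(1)]] xy 5(3) by simp
        then have "4 \<le> dK x + dK y" using gift_4(2)[OF v(2)] s by linarith
        moreover have "dK x \<le> 2" "dK y \<le> 2" using xt dK_le_d[of x] dK_le_d[of y] unfolding twos_def by auto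
        ultimately have "gift u x \<le> 3" "gift u y \<le> 3" using gift_le_3 xt by simp_all
        moreover have "?G = gift u v + (gift u x + gift u y)"
          using sum.remove[OF fin_parts(2) v(1), of "gift u"] xy by simp
        ultimately show ?thesis using gift_le[of u v] by linarith
      qed
      then show ?thesis using 5 by simp
    qed (use G4 k 4 in linarith)+
  qed
qed

section \<open>Summation over the graph without leaves\<close>

definition V2 :: "'a set" where "V2 = {v \<in> V. 2 \<le> d v}"
definition E2 :: "'a set set" where "E2 = {e \<in> E. e \<subseteq> V2}"

lemma fin2: "finite V2" "finite E2"
  using finV finE unfolding V2_def E2_def by auto

lemma k_degree:
  assumes "u \<in> V2" shows "k u = card {e \<in> E2. u \<in> e}"
proof -
  have "k u = card (twos u \<union> bigs u)"
    using N_partition[of u] fin_parts[of u] unfolding k_def by (subst card_Un_disjoint) auto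
  also have "\<dots> = card ((\<lambda>w. {u, w}) ` (twos u \<union> bigs u))"
    by (rule card_image[symmetric], rule inj_onI) (metis doubleton_eq_iff)
  also have "(\<lambda>w. {u, w}) ` (twos u \<union> bigs u) = {e \<in> E2. u \<in> e}"
  proof
    show "(\<lambda>w. {u, w}) ` (twos u \<union> bigs u) \<subseteq> {e \<in> E2. u \<in> e}"
    proof
      fix e assume "e \<in> (\<lambda>w. {u, w}) ` (twos u \<union> bigs u)"
      then obtain w where w: "e = {u, w}" "w \<in> N u" "2 \<le> d w" unfolding twos_def bigs_def by auto
      then have "w \<in> V2" using N_V[of w u] unfolding V2_def by simp
      then show "e \<in> {e \<in> E2. u \<in> e}" using w assms in_N[of w u] unfolding E2_def by simp
    qed
    show "{e \<in> E2. u \<in> e} \<subseteq> (\<lambda>w. {u, w}) ` (twos u \<union> bigs u)"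
    proof
      fix e assume e: "e \<in> {e \<in> E2. u \<in> e}"
      then have eE: "e \<in> E" "e \<subseteq> V2" "u \<in> e" unfolding E2_def by auto
      then obtain s t where "e = {s, t}" using edge[of e] by (metis card_2_iff)
      then obtain w where w: "e = {u, w}" using eE(3) by (metis insert_commute insert_iff singletonD)
      then have "w \<in> N u" "2 \<le> d w" using eE(1,2) in_N[of w u] unfolding V2_def by auto
      then have "w \<in> twos u \<union> bigs u" unfolding twos_def bigs_def by auto
      then show "e \<in> (\<lambda>w. {u, w}) ` (twos u \<union> bigs u)" using w by blast
    qed
  qed
  finally show ?thesis .
qed

lemma handshake: "(\<Sum>u\<in>V2. k u) = 2 * card E2"
proof -
  have "(\<Sum>u\<in>V2. k u) = (\<Sum>u\<in>V2. \<Sum>e | e \<in> E2 \<and> u \<in> e. 1)"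
    using k_degree by (intro sum.cong) simp_all
  also have "\<dots> = (\<Sum>e\<in>E2. \<Sum>u | u \<in> V2 \<and> u \<in> e. 1)"
    by (rule sum.swap_restrict) (rule fin2)+
  also have "\<dots> = (\<Sum>e\<in>E2. 2)"
  proof (rule sum.cong)
    fix e assume e: "e \<in> E2"
    then have "{u. u \<in> V2 \<and> u \<in> e} = e" unfolding E2_def by blast
    then show "(\<Sum>u | u \<in> V2 \<and> u \<in> e. 1) = (2::nat)" using e edge[of e] unfolding E2_def by simp
  qed simp
  finally show ?thesis by simp
qed

text \<open>A vertex of degree 2 has no leaf neighbour, so both of its neighbours lie in
  \<open>V2\<close>, and together they send it 4.\<close>

lemma total_gifts: "(\<Sum>u\<in>V2. \<Sum>v\<in>twos u. gift u v) = 4 * card {v \<in> V2. d v = 2}"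
proof -
  let ?T = "{v \<in> V2. d v = 2}"
  have tw: "twos u = {v. v \<in> ?T \<and> u \<in> N v}" for u
    using N_V[of _ u] N_sym[of _ u] unfolding twos_def V2_def by auto
  have "(\<Sum>u\<in>V2. \<Sum>v\<in>twos u. gift u v) = (\<Sum>v\<in>?T. \<Sum>u | u \<in> V2 \<and> u \<in> N v. gift u v)"
    unfolding tw by (rule sum.swap_restrict) (use fin2 in auto)
  also have "\<dots> = (\<Sum>v\<in>?T. 4)"
  proof (rule sum.cong)
    fix v assume v: "v \<in> ?T"
    then have d: "d v = 2" by simp
    then obtain u where u: "u \<in> N v" by fastforce
    then have vu: "v \<in> twos u" using d N_sym[of u v] unfolding twos_def by simp
    have "x \<in> V2" if "x \<in> N v" for x
    proof -
      have "x \<notin> leaves v" using k_eq_2[OF d] by simp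
      then have "d x \<noteq> 1" using that unfolding leaves_def by simp
      then show ?thesis using d_pos[OF that] N_V[OF that] unfolding V2_def by simp
    qed
    then have "{u. u \<in> V2 \<and> u \<in> N v} = {u, other u v}" using other(1)[OF vu] by blast
    then show "(\<Sum>u | u \<in> V2 \<and> u \<in> N v. gift u v) = 4"
      using gift_pair[OF vu] other(2)[OF vu] by simp
  qed simp
  finally show ?thesis by simp
qed

text \<open>Vertices of degree 2 lack exactly the 4 units that they receive, so the total charge
  \<open>10 * card E2 - 14 * card V2\<close> is nonnegative.\<close>

lemma dense: "7 * card V2 \<le> 5 * card E2"
proof -
  let ?G = "\<lambda>u. \<Sum>v\<in>twos u. gift u v"
  have "14 * card V2 + 4 * card {v \<in> V2. d v = 2} = (\<Sum>u\<in>V2. ?G u + 14)"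
    using total_gifts by (simp add: sum.distrib)
  also have "\<dots> \<le> (\<Sum>u\<in>V2. 5 * k u + (if d u = 2 then 4 else 0))"
  proof (rule sum_mono)
    fix u assume "u \<in> V2"
    then consider "d u = 2" | "3 \<le> d u" unfolding V2_def by fastforce
    then show "?G u + 14 \<le> 5 * k u + (if d u = 2 then 4 else 0)"
    proof cases
      case 1
      then have "?G u = 0" using gift_of_two by simp
      then show ?thesis using 1 k_eq_2[OF 1] by simp
    next
      case 2
      then show ?thesis using gifts_le_charge[OF 2] by simp
    qed
  qed
  also have "\<dots> = 10 * card E2 + 4 * card {v \<in> V2. d v = 2}"
    using handshake fin2 by (simp add: sum.distrib sum_distrib_left[symmetric] sum.If_cases Int_def)
  finally show ?thesis by linarith
qed

text \<open>If all degrees were at most 1, an edge of \<open>K\<close> would have no conflicts,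
  against \<open>3 * D > 0\<close>.\<close>

lemma V2_nonempty: "E \<noteq> {} \<Longrightarrow> V2 \<noteq> {}"
proof
  assume "E \<noteq> {}" and V2: "V2 = {}"
  then obtain e where "e \<in> E" by blast
  then obtain x where "x \<in> e" using edge[of e] by fastforce
  then obtain e' where "e' \<in> K" using cover \<open>e \<in> E\<close> by blast
  then obtain u v where uv: "e' = {u, v}" using edge[of e'] KE by (metis card_2_iff subsetD)
  have small: "N a - {b} = {}" if "{a, b} \<in> K" for a b
  proof -
    have b: "b \<in> N a" using that KE in_N by blast
    then have "d a \<le> 1" using V2 N_V[OF b] unfolding V2_def by fastforce
    then have "card (N a - {b}) = 0" using b finN by simp
    then show ?thesis using finN by simp
  qed
  have "{u, v} \<in> K" "{v, u} \<in> K" using \<open>e' \<in> K\<close> uv by (simp_all add: insert_commute)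
  then show False using conflict_count[of u v] small[of u v] small[of v u] D4 by simp
qed

end

section \<open>Coloring by induction\<close>

text \<open>Planarity and girth enter as sparsity of all subgraphs, which, like the degree bound,
  survives the deletion of edges.\<close>

lemma sparse_list_colorable:
  fixes L :: "'a set \<Rightarrow> 'c set"
  assumes "4 \<le> D" "simple_graph V E" "\<And>v. v \<in> V \<Longrightarrow> degree E v \<le> D"
    and "\<And>V' E'. V' \<subseteq> V \<Longrightarrow> V' \<noteq> {} \<Longrightarrow> E' \<subseteq> E \<Longrightarrow> \<Union>E' \<subseteq> V' \<Longrightarrow> 5 * card E' < 7 * card V'"
    and "\<And>e. e \<in> E \<Longrightarrow> infinite (L e) \<or> 3 * D \<le> card (L e)"
  shows "\<exists>c. list_proper (conflict E) L E c"
  using assms(2-)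
proof (induction "card E" arbitrary: E rule: less_induct)
  case less
  have finE: "finite E"
    by (rule finite_subset[of _ "Pow V"]) (use less.prems(1) in \<open>auto simp: simple_graph_def\<close>)
  show ?case
  proof (cases "E = {}")
    case True
    then show ?thesis unfolding list_proper_def by simp
  next
    case False
    have "\<exists>K\<subseteq>E. (\<forall>e\<in>K. 3 * D \<le> card {e' \<in> K. conflict E e e'}) \<and>
        (\<forall>c. list_proper (conflict E) L K c \<longrightarrow> (\<exists>c'. list_proper (conflict E) L E c'))"
      by (rule greedy_core[OF finE conflict_sym _ less.prems(4)]) (simp_all add: conflict_def)
    then obtain K where K: "K \<subseteq> E" "\<forall>e\<in>K. 3 * D \<le> card {e' \<in> K. conflict E e e'}"
      "\<forall>c. list_proper (conflict E) L K c \<longrightarrow> (\<exists>c'. list_proper (conflict E) L E c')"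
      by (elim exE conjE)
    have "\<exists>e\<in>E. \<exists>v\<in>e. \<forall>e'\<in>K. v \<notin> e'"
    proof (rule ccontr)
      assume "\<not> ?thesis"
      then interpret core_graph V E K D
        using assms(1) less.prems(1,2) K(1,2) by unfold_locales blast+
      have "5 * card E2 < 7 * card V2"
        by (rule less.prems(3)) (use V2_nonempty[OF False] in \<open>auto simp: V2_def E2_def\<close>)
      then show False using dense by simp
    qed
    then obtain e v where v: "e \<in> E" "v \<in> e" "\<forall>e'\<in>K. v \<notin> e'" by blast
    let ?E = "{e \<in> E. v \<notin> e}"
    have "card ?E < card E" by (rule psubset_card_mono) (use finE v in auto)
    moreover have "simple_graph V ?E" using less.prems(1) unfolding simple_graph_def by blast
    moreover have "degree ?E u \<le> D" if "u \<in> V" for u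
    proof -
      have "degree ?E u \<le> degree E u" unfolding degree_def by (rule card_mono) (use finE in auto)
      then show ?thesis using less.prems(2)[OF that] by linarith
    qed
    moreover have "5 * card E' < 7 * card V'"
      if "V' \<subseteq> V" "V' \<noteq> {}" "E' \<subseteq> ?E" "\<Union>E' \<subseteq> V'" for V' E'
      by (rule less.prems(3)) (use that in auto)
    ultimately obtain c where c: "list_proper (conflict ?E) L ?E c"
      using less.hyps[of ?E] less.prems(4) by blast
    text \<open>Deleting all edges at \<open>v\<close> leaves the conflicts between edges avoiding \<open>v\<close> unchanged.\<close>
    have same: "conflict ?E e e'" if ee: "e \<in> K" "e' \<in> K" "conflict E e e'" for e e'
    proof -
      obtain x y where "x \<in> e" "y \<in> e'" "{x, y} \<in> E" using ee(3) unfolding conflict_def by blast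
      moreover then have "v \<notin> {x, y}" using v(3) ee(1,2) by blast
      ultimately show ?thesis using ee(3) unfolding conflict_def by blast
    qed
    \<comment> \<open>Outside \<open>K\<close> the coloring \<open>c\<close> may violate conflicts
      through an edge at \<open>v\<close>, so only its values on \<open>K\<close> are kept.\<close>
    have "K \<subseteq> ?E" using K(1) v(3) by blast
    then have "list_proper (conflict E) L K c"
      using c same unfolding list_proper_def by (meson subsetD)
    then show ?thesis by (rule K(3)[rule_format])
  qed
qed

theorem theorem3p1:
  fixes V :: "'a set" and E :: "'a set set" and \<Delta> :: nat
  assumes "\<Delta> \<ge> 4"
    and "simple_graph V E"
    and "planar V E"
    and "\<forall>v\<in>V. degree E v \<le> \<Delta>"
    and "girth V E \<ge> 7"
  shows "list_strong_chromatic_index E \<le> 3 * \<Delta>"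
  unfolding list_strong_chromatic_index_def
proof (rule Least_le, intro allI impI)
  fix L :: "'a set \<Rightarrow> nat set"
  assume L: "\<forall>e\<in>E. infinite (L e) \<or> 3 * \<Delta> \<le> card (L e)"
  have "\<exists>c. list_proper (conflict E) L E c"
  proof (rule sparse_list_colorable)
    show "5 * card E' < 7 * card V'"
      if "V' \<subseteq> V" "V' \<noteq> {}" "E' \<subseteq> E" "\<Union>E' \<subseteq> V'" for V' E'
      by (rule planar_girth_7_sparse[OF assms(3,2,5) that])
    show "degree E v \<le> \<Delta>" if "v \<in> V" for v using assms(4) that by blast
    show "infinite (L e) \<or> 3 * \<Delta> \<le> card (L e)" if "e \<in> E" for e using L that by blast
  qed fact+
  then obtain c where "list_proper (conflict E) L E c" by blast
  then have "strong_L_coloring E L c"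
    unfolding strong_L_coloring_def list_proper_def by (auto intro: strong_edge_coloringI)
  then show "\<exists>c. strong_L_coloring E L c" by blast
qed

end
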